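(* Let $\mathcal{HOL}$ be the sheaf of holomorphic vector fields on $\mathbb{H}^2$, $\mathcal{HARM}$ the sheaf of harmonic vector fields on $\mathbb{H}^2$, and $\mathcal{HQD}$ the sheaf of holomorphic quadratic differentials on $\mathbb{H}^2$. Then $$\mathcal{HOL}\xrightarrow{\ \alpha\ }\mathcal{HARM}\xrightarrow{\ \beta\ }\mathcal{HQD}$$ is a short exact sequence of sheaves on $\mathbb{H}^2$, where $\alpha$ is the inclusion and $\beta(\xi)=(\mathcal{L}_\xi\mathbf{g}_{\mathbb{H}^2})^{(2,0)}$.
   Context: $\mathbb{H}^2=\{x+iy\in\mathbb{C}: y>0\}$ carries the metric $\mathbf{g}_{\mathbb{H}^2}=(dx^2+dy^2)/y^2$. The sheaves are regarded as sheaves of abelian groups (real vector spaces) under pointwise addition; "short exact" means that $\alpha$ is injective, $\operatorname{im}\alpha=\ker\beta$, and $\beta$ is surjective as a map of sheaves (i.e. locally surjective). Harmonic vector field: for a smooth map $\phi:U\to \mathbb{H}^2$ from an open set $U\subseteq \mathbb{H}^2$, the tension field is $\tau(\phi)=\mathrm{trace}(\nabla d\phi)$, where $\nabla$ is the connection on $T^*U\otimes\phi^{-1}T\mathbb{H}^2$ induced by the Levi-Civita connections. A smooth vector field $\xi$ on $U$ is harmonic if there is a smooth family of smooth maps $\phi_t:U\to \mathbb{H}^2$, $t\in[0,\epsilon)$, such that $\phi_0$ is the inclusion, $\frac{d\phi_t}{dt}|_{t=0}=\xi$, and $\frac{d}{dt}|_{t=0}\tau(\phi_t)(x)=0$ for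 all $x\in U$ (computed in the standard coordinates of $\mathbb{C}$). $(2,0)$-part: $\mathcal{L}_\xi\mathbf{g}_{\mathbb{H}^2}$ is the Lie derivative of the metric, a real symmetric bilinear form. Its trace-free part can be written uniquely as the real part of $f\,dz^2$ with $f$ complex-valued, and $(\mathcal{L}_\xi\mathbf{g}_{\mathbb{H}^2})^{(2,0)}:=f\,dz^2$. In coordinates, identifying $\xi=(\xi^1,\xi^2)$ with the function $\xi^1+i\xi^2$, one has $\overline{f(z)}=\frac{-8}{(z-\bar z)^2}\frac{\partial \xi}{\partial\bar z}$. For $\xi$ harmonic, $f$ is holomorphic. A holomorphic quadratic differential on $U$ is $f\,dz^2$ with $f$ holomorphic on $U$. *)

theory Defs
  imports "HOL-Analysis.Analysis" "HOL-Algebra.Module"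
begin

section \<open>Sheaves of real vector spaces\<close>

definition real_ring :: "real ring" where
  "real_ring = \<lparr>carrier = UNIV, monoid.mult = (*), one = 1, zero = 0, add = (+)\<rparr>"

definition real_vs :: "(real, 'b) module \<Rightarrow> bool" where
  "real_vs M \<longleftrightarrow> Module.module real_ring M"

definition vs_hom :: "(real, 'b) module \<Rightarrow> (real, 'c) module \<Rightarrow> ('b \<Rightarrow> 'c) set" where
  "vs_hom M N = {h. h \<in> carrier M \<rightarrow> carrier N \<and>
     (\<forall>x\<in>carrier M. \<forall>y\<in>carrier M. h (x \<oplus>\<^bsub>M\<^esub> y) = h x \<oplus>\<^bsub>N\<^esub> h y) \<and>
     (\<forall>a. \<forall>x\<in>carrier M. h (a \<odot>\<^bsub>M\<^esub> x) = a \<odot>\<^bsub>N\<^esub> h x)}"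

text \<open>Only the values of a presheaf on the open sets of the ambient space matter;
  \<open>res F U V\<close> is the restriction from \<open>U\<close> to a smaller open set \<open>V\<close>.\<close>

record ('a, 'b) presheaf =
  sections :: "'a set \<Rightarrow> (real, 'b) module"
  res :: "'a set \<Rightarrow> 'a set \<Rightarrow> 'b \<Rightarrow> 'b"

definition presheaf_on :: "'a topology \<Rightarrow> ('a, 'b) presheaf \<Rightarrow> bool" where
  "presheaf_on X F \<longleftrightarrow>
     (\<forall>U. openin X U \<longrightarrow> real_vs (sections F U)) \<and>
     (\<forall>U V. openin X U \<and> openin X V \<and> V \<subseteq> U \<longrightarrow>
        res F U V \<in> vs_hom (sections F U) (sections F V)) \<and>
     (\<forall>U. openin X U \<longrightarrow> (\<forall>s\<in>carrier (sections F U). res F U U s = s)) \<and>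
     (\<forall>U V W. openin X U \<and> openin X V \<and> openin X W \<and> W \<subseteq> V \<and> V \<subseteq> U \<longrightarrow>
        (\<forall>s\<in>carrier (sections F U). res F V W (res F U V s) = res F U W s))"

text \<open>The uniqueness in the gluing condition is the locality axiom; the cover may be empty,
  so that there is exactly one section over the empty set.\<close>

definition sheaf_on :: "'a topology \<Rightarrow> ('a, 'b) presheaf \<Rightarrow> bool" where
  "sheaf_on X F \<longleftrightarrow> presheaf_on X F \<and>
     (\<forall>\<V> s. (\<forall>V\<in>\<V>. openin X V \<and> s V \<in> carrier (sections F V)) \<and>
        (\<forall>V\<in>\<V>. \<forall>W\<in>\<V>. res F V (V \<inter> W) (s V) = res F W (V \<inter> W) (s W)) \<longrightarrow>
        (\<exists>!t. t \<in> carrier (sections F (\<Union>\<V>)) \<and> (\<forall>V\<in>\<V>. res F (\<Union>\<V>) V t = s V)))"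

definition sheaf_hom ::
  "'a topology \<Rightarrow> ('a, 'b) presheaf \<Rightarrow> ('a, 'c) presheaf \<Rightarrow> ('a set \<Rightarrow> 'b \<Rightarrow> 'c) \<Rightarrow> bool" where
  "sheaf_hom X F G h \<longleftrightarrow>
     (\<forall>U. openin X U \<longrightarrow> h U \<in> vs_hom (sections F U) (sections G U)) \<and>
     (\<forall>U V. openin X U \<and> openin X V \<and> V \<subseteq> U \<longrightarrow>
        (\<forall>s\<in>carrier (sections F U). h V (res F U V s) = res G U V (h U s)))"

definition sheaf_kernel ::
  "('a, 'b) presheaf \<Rightarrow> ('a, 'c) presheaf \<Rightarrow> ('a set \<Rightarrow> 'b \<Rightarrow> 'c) \<Rightarrow> 'a set \<Rightarrow> 'b set" where
  "sheaf_kernel F G h U = {s \<in> carrier (sections F U). h U s = \<zero>\<^bsub>sections G U\<^esub>}"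

text \<open>The image sheaf consists of the sections that lie locally in the image of \<open>h\<close>.\<close>

definition sheaf_image ::
  "'a topology \<Rightarrow> ('a, 'b) presheaf \<Rightarrow> ('a, 'c) presheaf \<Rightarrow> ('a set \<Rightarrow> 'b \<Rightarrow> 'c) \<Rightarrow>
   'a set \<Rightarrow> 'c set" where
  "sheaf_image X F G h U = {t \<in> carrier (sections G U).
     \<forall>x\<in>U. \<exists>V. openin X V \<and> x \<in> V \<and> V \<subseteq> U \<and> res G U V t \<in> h V ` carrier (sections F V)}"

definition short_exact_sheaves ::
  "'a topology \<Rightarrow> ('a, 'b) presheaf \<Rightarrow> ('a set \<Rightarrow> 'b \<Rightarrow> 'c) \<Rightarrow>
   ('a, 'c) presheaf \<Rightarrow> ('a set \<Rightarrow> 'c \<Rightarrow> 'd) \<Rightarrow> ('a, 'd) presheaf \<Rightarrow> bool" where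
  "short_exact_sheaves X F a G b H \<longleftrightarrow>
     sheaf_on X F \<and> sheaf_on X G \<and> sheaf_on X H \<and>
     sheaf_hom X F G a \<and> sheaf_hom X G H b \<and>
     (\<forall>U. openin X U \<longrightarrow> inj_on (a U) (carrier (sections F U))) \<and>
     (\<forall>U. openin X U \<longrightarrow> sheaf_image X F G a U = sheaf_kernel G H b U) \<and>
     (\<forall>U. openin X U \<longrightarrow> sheaf_image X G H b U = carrier (sections H U))"

text \<open>The presheaf of those vector-valued functions on \<open>U\<close> that satisfy \<open>P U\<close>. Functions on
  \<open>U\<close> are represented by their extension by \<open>undefined\<close>. The ring multiplication and unit of the
  record play no role in a module.\<close>

definition fun_presheaf ::
  "('a set \<Rightarrow> ('a \<Rightarrow> 'b::real_vector) \<Rightarrow> bool) \<Rightarrow> ('a, 'a \<Rightarrow> 'b) presheaf" where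
  "fun_presheaf P = \<lparr>
     sections = (\<lambda>U. \<lparr>carrier = {f \<in> extensional U. P U f},
        monoid.mult = undefined, one = undefined,
        zero = (\<lambda>x\<in>U. 0), add = (\<lambda>f g. \<lambda>x\<in>U. f x + g x),
        smult = (\<lambda>c f. \<lambda>x\<in>U. c *\<^sub>R f x)\<rparr>),
     res = (\<lambda>U V f. restrict f V)\<rparr>"



section \<open>Smooth maps\<close>

definition dderiv ::
  "('a::real_normed_vector \<Rightarrow> 'b::real_normed_vector) \<Rightarrow> 'a \<Rightarrow> 'a \<Rightarrow> 'b" where
  "dderiv f p v = frechet_derivative f (at p) v"

primrec Ck_on ::
  "nat \<Rightarrow> ('a::real_normed_vector \<Rightarrow> 'b::real_normed_vector) \<Rightarrow> 'a set \<Rightarrow> bool" where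
  "Ck_on 0 f U \<longleftrightarrow> continuous_on U f"
| "Ck_on (Suc k) f U \<longleftrightarrow>
     (\<forall>x\<in>U. f differentiable (at x)) \<and> (\<forall>v. Ck_on k (\<lambda>x. dderiv f x v) U)"

text \<open>On an arbitrary set \<open>S\<close>, smoothness means having smooth local extensions to open sets.\<close>

definition smooth_on ::
  "('a::euclidean_space) set \<Rightarrow> ('a \<Rightarrow> 'b::real_normed_vector) \<Rightarrow> bool" where
  "smooth_on S f \<longleftrightarrow>
     (\<forall>x\<in>S. \<exists>V g. open V \<and> x \<in> V \<and> (\<forall>k. Ck_on k g V) \<and> (\<forall>y\<in>S \<inter> V. g y = f y))"


section \<open>Riemannian metrics on open subsets of a Euclidean space\<close>

text \<open>\<open>g p v w\<close> is the inner product at \<open>p\<close> of the tangent vectors \<open>v\<close> and \<open>w\<close>.\<close>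

type_synonym 'a metric = "'a \<Rightarrow> 'a \<Rightarrow> 'a \<Rightarrow> real"

text \<open>The tangent vector at \<open>p\<close> dual to the covector \<open>l\<close>.\<close>

definition sharp :: "'a metric \<Rightarrow> 'a \<Rightarrow> ('a \<Rightarrow> real) \<Rightarrow> 'a" where
  "sharp g p l = (THE X. \<forall>w. g p X w = l w)"

text \<open>The Levi-Civita connection is \<open>\<nabla>\<^sub>u Y = D\<^sub>u Y + christoffel g p u Y\<close>; the formula is the
  Koszul formula for constant vector fields.\<close>

definition christoffel :: "('a::euclidean_space) metric \<Rightarrow> 'a \<Rightarrow> 'a \<Rightarrow> 'a \<Rightarrow> 'a" where
  "christoffel g p u v = sharp g p (\<lambda>w.
     (dderiv (\<lambda>q. g q v w) p u + dderiv (\<lambda>q. g q u w) p v - dderiv (\<lambda>q. g q u v) p w) / 2)"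

text \<open>\<open>tr\<^sub>g b = g\<^sup>i\<^sup>j b(e\<^sub>i, e\<^sub>j)\<close>, where \<open>\<lambda>w. i \<bullet> w\<close> is the coordinate covector of the basis
  vector \<open>i\<close>.\<close>

definition metric_trace ::
  "('a::euclidean_space) metric \<Rightarrow> 'a \<Rightarrow> ('a \<Rightarrow> 'a \<Rightarrow> 'b::real_vector) \<Rightarrow> 'b" where
  "metric_trace g p b = (\<Sum>i\<in>Basis. b i (sharp g p (\<lambda>w. i \<bullet> w)))"

text \<open>\<open>(\<nabla>d\<phi>)\<^sub>p(u, v)\<close> for \<open>\<phi>\<close> from \<open>(M, g)\<close> to \<open>(N, h)\<close>, i.e.
  \<open>\<nabla>\<^sub>u (d\<phi>(v)) - d\<phi>(\<nabla>\<^sub>u v)\<close> for the constant vector field \<open>v\<close>, where the first connection is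
  the pullback connection on \<open>\<phi>\<^sup>-\<^sup>1TN\<close>.\<close>

definition nabla_d ::
  "('a::euclidean_space) metric \<Rightarrow> ('b::euclidean_space) metric \<Rightarrow> ('a \<Rightarrow> 'b) \<Rightarrow>
   'a \<Rightarrow> 'a \<Rightarrow> 'a \<Rightarrow> 'b" where
  "nabla_d g h \<phi> p u v =
     dderiv (\<lambda>q. dderiv \<phi> q v) p u
     + christoffel h (\<phi> p) (dderiv \<phi> p u) (dderiv \<phi> p v)
     - dderiv \<phi> p (christoffel g p u v)"

definition tension ::
  "('a::euclidean_space) metric \<Rightarrow> ('b::euclidean_space) metric \<Rightarrow> ('a \<Rightarrow> 'b) \<Rightarrow> 'a \<Rightarrow> 'b" where
  "tension g h \<phi> p = metric_trace g p (nabla_d g h \<phi> p)"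

text \<open>\<open>(\<L>\<^sub>\<xi> g)(u, v) = \<xi>(g(u, v)) - g([\<xi>, u], v) - g(u, [\<xi>, v])\<close>, evaluated on constant
  vector fields, for which \<open>[\<xi>, u] = - D\<^sub>u \<xi>\<close>.\<close>

definition lie_metric :: "('a::euclidean_space) metric \<Rightarrow> ('a \<Rightarrow> 'a) \<Rightarrow> 'a \<Rightarrow> 'a \<Rightarrow> 'a \<Rightarrow> real" where
  "lie_metric g \<xi> p u v =
     dderiv (\<lambda>q. g q u v) p (\<xi> p) + g p (dderiv \<xi> p u) v + g p u (dderiv \<xi> p v)"

definition trace_free ::
  "('a::euclidean_space) metric \<Rightarrow> 'a \<Rightarrow> ('a \<Rightarrow> 'a \<Rightarrow> real) \<Rightarrow> 'a \<Rightarrow> 'a \<Rightarrow> real" where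
  "trace_free g p b u v = b u v - metric_trace g p b / real DIM('a) * g p u v"

text \<open>The coefficient \<open>f\<close> of the (2,0)-part \<open>f dz\<^sup>2\<close> of a symmetric bilinear form on a planar
  domain; here \<open>dz\<^sup>2(u, v) = u * v\<close>.\<close>

definition part20 :: "complex metric \<Rightarrow> complex \<Rightarrow> (complex \<Rightarrow> complex \<Rightarrow> real) \<Rightarrow> complex" where
  "part20 g p b = (THE f. \<forall>u v. trace_free g p b u v = Re (f * u * v))"


section \<open>Vector fields and quadratic differentials on the hyperbolic plane\<close>

definition H2 :: "complex set" where
  "H2 = {z. Im z > 0}"

definition hyp_metric :: "complex metric" where
  "hyp_metric p v w = (v \<bullet> w) / (Im p)\<^sup>2"

definition harmonic_field :: "complex set \<Rightarrow> (complex \<Rightarrow> complex) \<Rightarrow> bool" where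
  "harmonic_field U \<xi> \<longleftrightarrow> smooth_on U \<xi> \<and>
     (\<exists>\<epsilon>>0. \<exists>\<phi> :: real \<Rightarrow> complex \<Rightarrow> complex.
        smooth_on ({0..<\<epsilon>} \<times> U) (\<lambda>(t, z). \<phi> t z) \<and>
        (\<forall>t\<in>{0..<\<epsilon>}. \<phi> t ` U \<subseteq> H2) \<and>
        (\<forall>z\<in>U. \<phi> 0 z = z) \<and>
        (\<forall>z\<in>U. ((\<lambda>t. \<phi> t z) has_vector_derivative \<xi> z) (at 0 within {0..<\<epsilon>})) \<and>
        (\<forall>z\<in>U. ((\<lambda>t. tension hyp_metric hyp_metric (\<phi> t) z) has_vector_derivative 0)
                  (at 0 within {0..<\<epsilon>})))"

definition HOL_sheaf :: "(complex, complex \<Rightarrow> complex) presheaf" where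
  "HOL_sheaf = fun_presheaf (\<lambda>U \<xi>. \<xi> holomorphic_on U)"

definition HARM_sheaf :: "(complex, complex \<Rightarrow> complex) presheaf" where
  "HARM_sheaf = fun_presheaf harmonic_field"

text \<open>The quadratic differential \<open>f dz\<^sup>2\<close> is represented by its coefficient \<open>f\<close> with respect to
  the global frame \<open>dz\<^sup>2\<close>, as the vector field \<open>\<xi>\<^sup>1 \<partial>\<^sub>x + \<xi>\<^sup>2 \<partial>\<^sub>y\<close> is by \<open>\<xi>\<^sup>1 + i \<xi>\<^sup>2\<close>.\<close>

definition HQD_sheaf :: "(complex, complex \<Rightarrow> complex) presheaf" where
  "HQD_sheaf = fun_presheaf (\<lambda>U f. f holomorphic_on U)"

definition alpha :: "complex set \<Rightarrow> (complex \<Rightarrow> complex) \<Rightarrow> (complex \<Rightarrow> complex)" where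
  "alpha U \<xi> = \<xi>"

definition beta :: "complex set \<Rightarrow> (complex \<Rightarrow> complex) \<Rightarrow> (complex \<Rightarrow> complex)" where
  "beta U \<xi> = (\<lambda>p\<in>U. part20 hyp_metric p (lie_metric hyp_metric \<xi> p))"

end

theory Submission
  imports Defs "HOL-Complex_Analysis.Cauchy_Integral_Formula"
begin

text \<open>
  In the coordinate of the half plane the tension field of \<open>\<phi>\<close> is
  \<open>y\<^sup>2 (\<Delta>\<phi> + \<i> (\<phi>\<^sub>x\<^sup>2 + \<phi>\<^sub>y\<^sup>2) / Im \<phi>)\<close>. Its linearisation at the identity is
  \<open>y\<^sup>2 (\<Delta>\<xi> + 2 \<i> (\<xi>\<^sub>x + \<i> \<xi>\<^sub>y) / y)\<close>, and this vanishes exactly when the coefficient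
  \<open>cnj (\<xi>\<^sub>x + \<i> \<xi>\<^sub>y) / y\<^sup>2\<close> of \<open>\<beta> \<xi>\<close> satisfies the Cauchy-Riemann equations. Hence a smooth
  \<open>\<xi>\<close> is harmonic if and only if \<open>\<beta> \<xi>\<close> is holomorphic, and the kernel of \<open>\<beta>\<close> consists of
  the solutions of \<open>\<xi>\<^sub>x + \<i> \<xi>\<^sub>y = 0\<close>. Surjectivity amounts to solving a
  \<open>\<partial>/\<partial>cnj z\<close>-equation on discs, which is explicit because the right-hand side is a
  polynomial in \<open>z\<close> with antiholomorphic coefficients.
\<close>

section \<open>Directional derivatives and \<open>C\<^sup>k\<close> maps\<close>

lemma dderiv_eq: "(f has_derivative D) (at x) \<Longrightarrow> dderiv f x v = D v"
  by (metis dderiv_def frechet_derivative_at)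

lemma has_derivative_dderiv: "f differentiable (at x) \<Longrightarrow> (f has_derivative dderiv f x) (at x)"
  by (metis dderiv_def ext frechet_derivative_works)

text \<open>Both functions have the same derivatives at \<open>x\<close>, so the choice behind
  \<open>frechet_derivative\<close> returns the same value for both, even where no derivative
  exists.\<close>

lemma dderiv_cong:
  assumes "open U" "x \<in> U" "\<And>y. y \<in> U \<Longrightarrow> f y = g y"
  shows "dderiv f x v = dderiv g x v"
proof -
  have "(f has_derivative D) (at x) \<longleftrightarrow> (g has_derivative D) (at x)" for D
    using assms by (metis has_derivative_transform_within_open)
  then show ?thesis
    by (simp add: dderiv_def frechet_derivative_def)
qed

lemma Ck_on_cong:
  assumes "open U" "\<And>y. y \<in> U \<Longrightarrow> f y = g y"
  shows "Ck_on k f U \<longleftrightarrow> Ck_on k g U"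
  using assms(2)
proof (induction k arbitrary: f g)
  case 0
  then show ?case by (simp cong: continuous_on_cong)
next
  case (Suc k)
  have "f differentiable (at x) \<longleftrightarrow> g differentiable (at x)" if "x \<in> U" for x
    unfolding differentiable_def using assms(1) Suc.prems that
    by (metis has_derivative_transform_within_open)
  moreover have "Ck_on k (\<lambda>x. dderiv f x v) U \<longleftrightarrow> Ck_on k (\<lambda>x. dderiv g x v) U" for v
    by (rule Suc.IH) (use assms(1) Suc.prems dderiv_cong in blast)
  ultimately show ?case by simp
qed

lemma Ck_on_SucD: "Ck_on (Suc k) f U \<Longrightarrow> Ck_on k f U"
proof (induction k arbitrary: f)
  case 0
  then show ?case
    by (auto intro!: continuous_at_imp_continuous_on differentiable_imp_continuous_within)
next
  case (Suc k)
  then show ?case by (metis Ck_on.simps(2))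
qed

lemma Ck_on_subset: "Ck_on k f U \<Longrightarrow> V \<subseteq> U \<Longrightarrow> Ck_on k f V"
  by (induction k arbitrary: f) (auto intro: continuous_on_subset)

text \<open>Derivatives in \<open>Ck_on\<close> are taken \<open>at x\<close>, not within
  \<open>U\<close>, and on an open \<open>V\<close> continuity is pointwise; hence regularity passes
  from neighbourhoods to \<open>U\<close>.\<close>

lemma Ck_on_local:
  assumes "\<And>x. x \<in> U \<Longrightarrow> \<exists>V. open V \<and> x \<in> V \<and> Ck_on k f V"
  shows "Ck_on k f U"
  using assms
proof (induction k arbitrary: f)
  case 0
  then show ?case
    unfolding Ck_on.simps
    by (intro continuous_at_imp_continuous_on ballI) (meson continuous_on_eq_continuous_at)
next
  case (Suc k)
  have "f differentiable at x" if "x \<in> U" for x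
    using Suc.prems[OF that] by auto
  moreover have "Ck_on k (\<lambda>x. dderiv f x v) U" for v
  proof (rule Suc.IH)
    fix x assume "x \<in> U"
    from Suc.prems[OF this] show "\<exists>V. open V \<and> x \<in> V \<and> Ck_on k (\<lambda>x. dderiv f x v) V" by auto
  qed
  ultimately show ?case by simp
qed

lemma Ck_on_const:
  fixes U :: "'a::real_normed_vector set"
  shows "Ck_on k (\<lambda>x. c) U"
proof (induction k arbitrary: c)
  case (Suc k)
  have "dderiv (\<lambda>x. c) x v = 0" for x v :: 'a
    by (rule dderiv_eq[where D="\<lambda>_. 0"]) simp
  then show ?case by (simp only: Ck_on.simps Suc.IH) simp
qed simp

lemma Ck_on_bounded_linear:
  assumes "bounded_linear L"
  shows "Ck_on k L U"
proof (cases k)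
  case (Suc m)
  have L: "(L has_derivative L) (at x)" for x
    using assms by (rule bounded_linear_imp_has_derivative)
  then have "dderiv L x v = L v" for x v
    by (rule dderiv_eq)
  with Suc L show ?thesis
    by (auto simp: Ck_on_const differentiable_def)
qed (use assms linear_continuous_on in auto)

lemma Ck_on_add:
  assumes "open U" "Ck_on k f U" "Ck_on k g U"
  shows "Ck_on k (\<lambda>x. f x + g x) U"
  using assms(2,3)
proof (induction k arbitrary: f g)
  case 0
  then show ?case by (auto intro: continuous_on_add)
next
  case (Suc k)
  have "dderiv (\<lambda>x. f x + g x) x v = dderiv f x v + dderiv g x v" if "x \<in> U" for x v
    using Suc.prems that
    by (intro dderiv_eq[where D="\<lambda>v. dderiv f x v + dderiv g x v"])
       (auto intro!: has_derivative_add has_derivative_dderiv)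
  then have "Ck_on k (\<lambda>x. dderiv (\<lambda>x. f x + g x) x v) U" for v
    using Suc by (subst Ck_on_cong[OF assms(1)]) auto
  with Suc.prems show ?case by auto
qed

text \<open>By the Leibniz rule the derivative is a sum of two terms of the same shape
  \<open>B (_) (_)\<close>, so the induction closes when both arguments are generalised.\<close>

lemma Ck_on_bilinear:
  assumes "open U" "bounded_bilinear B" "Ck_on k f U" "Ck_on k g U"
  shows "Ck_on k (\<lambda>x. B (f x) (g x)) U"
  using assms(3,4)
proof (induction k arbitrary: f g)
  case 0
  then show ?case by (auto intro: bounded_bilinear.continuous_on[OF assms(2)])
next
  case (Suc k)
  have D: "((\<lambda>x. B (f x) (g x)) has_derivative
      (\<lambda>v. B (f x) (dderiv g x v) + B (dderiv f x v) (g x))) (at x)" if "x \<in> U" for x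
    using Suc.prems that
    by (intro bounded_bilinear.FDERIV[OF assms(2)] has_derivative_dderiv) auto
  have "Ck_on k (\<lambda>x. dderiv (\<lambda>x. B (f x) (g x)) x v) U" for v
  proof (subst Ck_on_cong[OF assms(1) dderiv_eq[OF D]])
    show "Ck_on k (\<lambda>x. B (f x) (dderiv g x v) + B (dderiv f x v) (g x)) U"
      using Suc.prems by (intro Ck_on_add[OF assms(1)] Suc.IH)(auto dest: Ck_on_SucD simp del: Ck_on.simps(2), auto)
  qed
  with D show ?case by (auto simp: differentiable_def)
qed

lemma Ck_on_linear_image:
  assumes "open U" "bounded_linear L" "Ck_on k f U"
  shows "Ck_on k (\<lambda>x. L (f x)) U"
  using assms(3)
proof (induction k arbitrary: f)
  case 0
  then show ?case using bounded_linear.continuous_on[OF assms(2)] by auto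
next
  case (Suc k)
  have D: "((\<lambda>x. L (f x)) has_derivative (\<lambda>v. L (dderiv f x v))) (at x)" if "x \<in> U" for x
    using bounded_linear.has_derivative[OF assms(2) has_derivative_dderiv] Suc.prems that by auto
  have "Ck_on k (\<lambda>x. dderiv (\<lambda>x. L (f x)) x v) U" for v
    using Suc by (subst Ck_on_cong[OF assms(1) dderiv_eq[OF D]]) auto
  with D show ?case by (auto simp: differentiable_def)
qed

lemma open_affine_vimage:
  assumes "open U" "bounded_linear L"
  shows "open {x. a + L x \<in> U}"
proof -
  have "continuous_on UNIV (\<lambda>x. a + L x)"
    by (intro continuous_intros linear_continuous_on assms(2))
  with assms(1) show ?thesis
    by (simp add: open_vimage flip: vimage_def)
qed

text \<open>The substitutions made below are affine: freezing the time, and projecting to the space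
  variable. Their derivative is constant, so the chain rule reproduces the shape of the
  statement.\<close>

lemma Ck_on_compose_affine:
  assumes "open U" "bounded_linear L" "Ck_on k f U"
  shows "Ck_on k (\<lambda>x. f (a + L x)) {x. a + L x \<in> U}"
  using assms(3)
proof (induction k arbitrary: f)
  case 0
  have "continuous_on {x. a + L x \<in> U} (\<lambda>x. a + L x)"
    by (intro continuous_intros linear_continuous_on assms(2))
  with 0 show ?case
    unfolding Ck_on.simps by (rule continuous_on_compose2) auto
next
  case (Suc k)
  have D: "((\<lambda>x. f (a + L x)) has_derivative (\<lambda>v. dderiv f (a + L x) (L v))) (at x)"
    if "x \<in> {x. a + L x \<in> U}" for x
  proof -
    have "((\<lambda>x. a + L x) has_derivative L) (at x)"
      using has_derivative_add[OF has_derivative_const bounded_linear_imp_has_derivative[OF assms(2)]]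
      by simp
    moreover have "(f has_derivative dderiv f (a + L x)) (at (a + L x))"
      using Suc.prems that by (intro has_derivative_dderiv) auto
    ultimately show ?thesis
      by (rule has_derivative_compose)
  qed
  have "Ck_on k (\<lambda>x. dderiv (\<lambda>x. f (a + L x)) x v) {x. a + L x \<in> U}" for v
    using Suc
    by (subst Ck_on_cong[OF open_affine_vimage[OF assms(1,2)] dderiv_eq[OF D]]) auto
  with D show ?case
    by (auto simp: differentiable_def)
qed

text \<open>The derivative of \<open>1 / f\<close> is \<open>- f' / f\<^sup>2\<close>, which is
  built from \<open>f'\<close> and \<open>1 / f\<close> itself; the latter is covered by the
  induction hypothesis.\<close>

lemma Ck_on_inverse:
  fixes f :: "'a::real_normed_vector \<Rightarrow> 'b::real_normed_field"
  assumes "open U" "Ck_on k f U" "\<And>x. x \<in> U \<Longrightarrow> f x \<noteq> 0"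
  shows "Ck_on k (\<lambda>x. inverse (f x)) U"
  using assms(2)
proof (induction k)
  case 0
  then show ?case using assms(3) by (auto intro: continuous_on_inverse)
next
  case (Suc k)
  have D: "((\<lambda>x. inverse (f x)) has_derivative
      (\<lambda>v. (-1) * (inverse (f x) * dderiv f x v * inverse (f x)))) (at x)" if "x \<in> U" for x
    using Suc.prems assms(3)[OF that] that Deriv.has_derivative_inverse[OF _ has_derivative_dderiv[of f x]] by simp
  have "Ck_on k (\<lambda>x. dderiv (\<lambda>x. inverse (f x)) x v) U" for v
  proof (subst Ck_on_cong[OF assms(1) dderiv_eq[OF D]])
    show "Ck_on k (\<lambda>x. (-1) * (inverse (f x) * dderiv f x v * inverse (f x))) U"
      using Suc.prems Suc.IH[OF Ck_on_SucD[OF Suc.prems]]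
      by (intro Ck_on_bilinear[OF assms(1) bounded_bilinear_mult] Ck_on_const) auto
  qed
  with D show ?case by (auto simp: differentiable_def)
qed

section \<open>Symmetry of second derivatives\<close>

text \<open>Schwarz's theorem: the second difference of \<open>f\<close> over a small parallelogram
  is symmetric in \<open>u\<close> and \<open>v\<close>, and two mean value theorems express it by
  either mixed derivative at a nearby point. Continuity then excludes different values at
  \<open>x\<close>.\<close>

lemma dderiv_commute_real:
  fixes f :: "'a::real_normed_vector \<Rightarrow> real"
  assumes "open U" "x \<in> U" "Ck_on 2 f U"
  shows "dderiv (\<lambda>y. dderiv f y u) x v = dderiv (\<lambda>y. dderiv f y v) x u"
proof (rule ccontr)
  let ?D = "\<lambda>u v y. dderiv (\<lambda>y. dderiv f y u) y v"
  assume ne: "?D u v x \<noteq> ?D v u x"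
  \<comment> \<open>Half the gap: two equal numbers cannot lie within \<open>e\<close> of the two
    distinct values.\<close>
  define e where "e = \<bar>?D u v x - ?D v u x\<bar> / 2"
  have e: "e > 0" using ne by (simp add: e_def)
  have C2: "\<forall>x\<in>U. f differentiable at x" "\<And>w. \<forall>x\<in>U. (\<lambda>y. dderiv f y w) differentiable at x"
    "\<And>a b. continuous_on U (?D a b)"
    using assms(3) by (auto simp: numeral_2_eq_2)
  have cont: "isCont (?D a b) x" for a b
    using C2(3) assms(1,2) continuous_on_eq_continuous_at by blast
  have ev: "\<forall>\<^sub>F y in nhds x. dist (?D a b y) (?D a b x) < e" for a b
    using cont[of a b, unfolded isCont_def] tendsto_at_iff_tendsto_nhds[of "?D a b" x] e
    by (simp add: tendstoD)
  have "\<forall>\<^sub>F y in nhds x. y \<in> U \<and> dist (?D u v y) (?D u v x) < e \<and> dist (?D v u y) (?D v u x) < e"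
    using ev assms(1,2) by (intro eventually_conj eventually_nhds_in_open)
  then obtain r where r: "r > 0"
    "\<And>y. dist y x < r \<Longrightarrow> y \<in> U \<and> dist (?D u v y) (?D u v x) < e \<and> dist (?D v u y) (?D v u x) < e"
    unfolding eventually_nhds_metric by auto
  \<comment> \<open>The parallelogram with sides \<open>h *\<^sub>R u\<close> and
    \<open>h *\<^sub>R v\<close> stays inside the ball of radius \<open>r\<close>; the summand 1
    keeps the denominator positive.\<close>
  define h where "h = r / (2 * (norm u + norm v + 1))"
  have h: "h > 0" using r(1) by (auto simp: h_def intro!: divide_pos_pos add_nonneg_pos)
  have near: "dist (x + s *\<^sub>R a + t *\<^sub>R b) x < r"
    if "0 \<le> s" "s \<le> h" "0 \<le> t" "t \<le> h" "(a = u \<and> b = v) \<or> (a = v \<and> b = u)" for s t a b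
  proof -
    have "dist (x + s *\<^sub>R a + t *\<^sub>R b) x \<le> s * norm a + t * norm b"
      using norm_triangle_ineq[of "s *\<^sub>R a" "t *\<^sub>R b"] that by (simp add: dist_norm add.assoc)
    also have "\<dots> \<le> h * norm a + h * norm b"
      using that by (intro add_mono mult_right_mono) auto
    also have "\<dots> = h * (norm u + norm v)"
      using that(5) by (auto simp: algebra_simps)
    also have "\<dots> < h * (2 * (norm u + norm v + 1))"
    proof (rule mult_strict_left_mono[OF _ h])
      have "0 \<le> norm u" "0 \<le> norm v" by simp_all
      then show "norm u + norm v < 2 * (norm u + norm v + 1)" by (simp add: distrib_left add_nonneg_pos)
    qed
    also have "\<dots> = r"
      unfolding h_def using norm_ge_zero[of u] norm_ge_zero[of v] by (simp add: add_nonneg_eq_0_iff)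
    finally show ?thesis .
  qed
  \<comment> \<open>Stated for both orders of the directions, because the left-hand side is the same
    number for \<open>(u, v)\<close> and \<open>(v, u)\<close>.\<close>
  have mvt: "\<exists>s t. 0 \<le> s \<and> s \<le> h \<and> 0 \<le> t \<and> t \<le> h \<and>
      f (x + h *\<^sub>R a + h *\<^sub>R b) - f (x + h *\<^sub>R b) - f (x + h *\<^sub>R a) + f x
      = h * (h * ?D a b (x + s *\<^sub>R a + t *\<^sub>R b))"
    if ab: "(a = u \<and> b = v) \<or> (a = v \<and> b = u)" for a b
  proof -
    have df: "((\<lambda>s. f (x + s *\<^sub>R a + t *\<^sub>R b)) has_real_derivative dderiv f (x + s *\<^sub>R a + t *\<^sub>R b) a) (at s)"
      if "0 \<le> s" "s \<le> h" "0 \<le> t" "t \<le> h" for s t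
    proof -
      have "(f has_derivative dderiv f (x + s *\<^sub>R a + t *\<^sub>R b)) (at (x + s *\<^sub>R a + t *\<^sub>R b))"
        using near[OF that ab] r(2) C2(1) by (blast intro: has_derivative_dderiv)
      moreover have "((\<lambda>s. x + s *\<^sub>R a + t *\<^sub>R b) has_derivative (\<lambda>k. k *\<^sub>R a)) (at s)"
        by (auto intro!: derivative_eq_intros)
      ultimately have "((\<lambda>s. f (x + s *\<^sub>R a + t *\<^sub>R b)) has_derivative
          (\<lambda>k. dderiv f (x + s *\<^sub>R a + t *\<^sub>R b) (k *\<^sub>R a))) (at s)"
        by (rule has_derivative_compose[rotated])
      moreover have "dderiv f (x + s *\<^sub>R a + t *\<^sub>R b) (k *\<^sub>R a) = dderiv f (x + s *\<^sub>R a + t *\<^sub>R b) a * k" for k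
        using has_derivative_linear[OF \<open>(f has_derivative _) _\<close>] by (simp add: linear_scale)
      ultimately show ?thesis by (simp add: has_field_derivative_def)
    qed
    \<comment> \<open>First mean value theorem, along \<open>a\<close>, for the difference of
      \<open>f\<close> on the two opposite sides; the second one, along \<open>b\<close>, is applied
      to the resulting increment of \<open>dderiv f _ a\<close>.\<close>
    obtain s where s: "0 < s" "s < h"
      "(f (x + h *\<^sub>R a + h *\<^sub>R b) - f (x + h *\<^sub>R a + 0 *\<^sub>R b)) - (f (x + 0 *\<^sub>R a + h *\<^sub>R b) - f (x + 0 *\<^sub>R a + 0 *\<^sub>R b))
       = (h - 0) * (dderiv f (x + s *\<^sub>R a + h *\<^sub>R b) a - dderiv f (x + s *\<^sub>R a + 0 *\<^sub>R b) a)"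
      using MVT2[OF h, of "\<lambda>s. f (x + s *\<^sub>R a + h *\<^sub>R b) - f (x + s *\<^sub>R a + 0 *\<^sub>R b)"
         "\<lambda>s. dderiv f (x + s *\<^sub>R a + h *\<^sub>R b) a - dderiv f (x + s *\<^sub>R a + 0 *\<^sub>R b) a"]
        df h by (force intro: DERIV_diff)
    have dg: "((\<lambda>t. dderiv f (x + s *\<^sub>R a + t *\<^sub>R b) a) has_real_derivative ?D a b (x + s *\<^sub>R a + t *\<^sub>R b)) (at t)"
      if "0 \<le> t" "t \<le> h" for t
    proof -
      let ?g = "\<lambda>y. dderiv f y a"
      have "(?g has_derivative dderiv ?g (x + s *\<^sub>R a + t *\<^sub>R b)) (at (x + s *\<^sub>R a + t *\<^sub>R b))"
        using near[OF _ _ that ab] s r(2) C2(2) by (force intro: has_derivative_dderiv)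
      moreover have "((\<lambda>t. x + s *\<^sub>R a + t *\<^sub>R b) has_derivative (\<lambda>k. k *\<^sub>R b)) (at t)"
        by (auto intro!: derivative_eq_intros)
      ultimately have "((\<lambda>t. ?g (x + s *\<^sub>R a + t *\<^sub>R b)) has_derivative
          (\<lambda>k. dderiv ?g (x + s *\<^sub>R a + t *\<^sub>R b) (k *\<^sub>R b))) (at t)"
        by (rule has_derivative_compose[rotated])
      moreover have "dderiv ?g (x + s *\<^sub>R a + t *\<^sub>R b) (k *\<^sub>R b) = dderiv ?g (x + s *\<^sub>R a + t *\<^sub>R b) b * k" for k
        using has_derivative_linear[OF \<open>(?g has_derivative _) _\<close>] by (simp add: linear_scale)
      ultimately show ?thesis by (simp add: has_field_derivative_def)
    qed
    obtain t where t: "0 < t" "t < h"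
      "dderiv f (x + s *\<^sub>R a + h *\<^sub>R b) a - dderiv f (x + s *\<^sub>R a + 0 *\<^sub>R b) a
       = (h - 0) * ?D a b (x + s *\<^sub>R a + t *\<^sub>R b)"
      using MVT2[OF h, of "\<lambda>t. dderiv f (x + s *\<^sub>R a + t *\<^sub>R b) a"
          "\<lambda>t. ?D a b (x + s *\<^sub>R a + t *\<^sub>R b)", OF dg] by blast
    have "f (x + h *\<^sub>R a + h *\<^sub>R b) - f (x + h *\<^sub>R a) - (f (x + h *\<^sub>R b) - f x)
        = h * (h * ?D a b (x + s *\<^sub>R a + t *\<^sub>R b))"
      using s(3) unfolding t(3) by (simp only: scaleR_zero_left add_0_right diff_zero)
    then have "f (x + h *\<^sub>R a + h *\<^sub>R b) - f (x + h *\<^sub>R b) - f (x + h *\<^sub>R a) + f x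
        = h * (h * ?D a b (x + s *\<^sub>R a + t *\<^sub>R b))"
      by linarith
    with s(1,2) t(1,2) show ?thesis
      using less_imp_le by blast
  qed
  from mvt[of u v] obtain s t where st: "0 \<le> s" "s \<le> h" "0 \<le> t" "t \<le> h"
    "f (x + h *\<^sub>R u + h *\<^sub>R v) - f (x + h *\<^sub>R v) - f (x + h *\<^sub>R u) + f x
      = h * (h * ?D u v (x + s *\<^sub>R u + t *\<^sub>R v))" by auto
  from mvt[of v u] obtain s' t' where st': "0 \<le> s'" "s' \<le> h" "0 \<le> t'" "t' \<le> h"
    "f (x + h *\<^sub>R v + h *\<^sub>R u) - f (x + h *\<^sub>R u) - f (x + h *\<^sub>R v) + f x
      = h * (h * ?D v u (x + s' *\<^sub>R v + t' *\<^sub>R u))" by auto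
  have "?D u v (x + s *\<^sub>R u + t *\<^sub>R v) = ?D v u (x + s' *\<^sub>R v + t' *\<^sub>R u)"
  proof -
    have *: "x + h *\<^sub>R v + h *\<^sub>R u = x + h *\<^sub>R u + h *\<^sub>R v" by simp
    from st(5) st'(5)[unfolded *] have "h * (h * ?D u v (x + s *\<^sub>R u + t *\<^sub>R v)) = h * (h * ?D v u (x + s' *\<^sub>R v + t' *\<^sub>R u))"
      by linarith
    with h show ?thesis by simp
  qed
  moreover have "dist (?D u v (x + s *\<^sub>R u + t *\<^sub>R v)) (?D u v x) < e"
    using r(2) near[OF st(1-4)] by blast
  moreover have "dist (?D v u (x + s' *\<^sub>R v + t' *\<^sub>R u)) (?D v u x) < e"
    using r(2) near[OF st'(1-4)] by blast
  moreover have False if "p = q" "dist p a < \<bar>a - b\<bar> / 2" "dist q b < \<bar>a - b\<bar> / 2" for p q a b :: real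
    using that unfolding dist_real_def by argo
  ultimately show False
    unfolding e_def by blast
qed

text \<open>The mean value theorem is a statement about real functions, so the vector-valued case is
  tested against every fixed vector \<open>b\<close>.\<close>

lemma dderiv_commute:
  fixes f :: "'a::real_normed_vector \<Rightarrow> 'b::real_inner"
  assumes "open U" "x \<in> U" "Ck_on 2 f U"
  shows "dderiv (\<lambda>y. dderiv f y u) x v = dderiv (\<lambda>y. dderiv f y v) x u"
proof -
  have *: "dderiv (\<lambda>y. dderiv (\<lambda>z. f z \<bullet> b) y u) x v = dderiv (\<lambda>y. dderiv f y u) x v \<bullet> b" for u v b
  proof -
    have "dderiv (\<lambda>z. f z \<bullet> b) y u = dderiv f y u \<bullet> b" if "y \<in> U" for y
      using assms(3) that
      by (intro dderiv_eq[where D="\<lambda>v. dderiv f y v \<bullet> b"] has_derivative_inner_left has_derivative_dderiv)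
         (auto simp: numeral_2_eq_2)
    then have "dderiv (\<lambda>y. dderiv (\<lambda>z. f z \<bullet> b) y u) x v = dderiv (\<lambda>y. dderiv f y u \<bullet> b) x v"
      by (rule dderiv_cong[OF assms(1,2)])
    also have "\<dots> = dderiv (\<lambda>y. dderiv f y u) x v \<bullet> b"
      using assms(2,3)
      by (intro dderiv_eq[where D="\<lambda>v. dderiv (\<lambda>y. dderiv f y u) x v \<bullet> b"]
            has_derivative_inner_left has_derivative_dderiv) (auto simp: numeral_2_eq_2)
    finally show ?thesis .
  qed
  have "dderiv (\<lambda>y. dderiv f y u) x v \<bullet> b = dderiv (\<lambda>y. dderiv f y v) x u \<bullet> b" for b
    using dderiv_commute_real[OF assms(1,2) Ck_on_linear_image[OF assms(1) bounded_linear_inner_left assms(3)]]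
    by (simp add: * )
  then show ?thesis using vector_eq_rdot by blast
qed

section \<open>Smooth maps on open sets\<close>

text \<open>On an open set a local extension coincides with \<open>f\<close> near the point, so its
  regularity is that of \<open>f\<close>.\<close>

lemma smooth_on_open:
  assumes "open U"
  shows "smooth_on U f \<longleftrightarrow> (\<forall>k. Ck_on k f U)"
proof (intro iffI allI)
  fix k assume sm: "smooth_on U f"
  show "Ck_on k f U"
  proof (rule Ck_on_local)
    fix x assume "x \<in> U"
    with sm obtain V g where g: "open V" "x \<in> V" "\<And>k. Ck_on k g V" "\<And>y. y \<in> U \<inter> V \<Longrightarrow> g y = f y"
      unfolding smooth_on_def by meson
    have "Ck_on k f (U \<inter> V)"
      using Ck_on_subset[OF g(3)] Ck_on_cong[of "U \<inter> V" g f k] g assms by auto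
    then show "\<exists>V. open V \<and> x \<in> V \<and> Ck_on k f V"
      using g \<open>x \<in> U\<close> assms by (intro exI[of _ "U \<inter> V"]) auto
  qed
qed (use assms in \<open>auto simp: smooth_on_def\<close>)

lemma smooth_on_cong: "(\<And>x. x \<in> S \<Longrightarrow> f x = g x) \<Longrightarrow> smooth_on S f \<longleftrightarrow> smooth_on S g"
  by (simp add: smooth_on_def)

lemma smooth_on_subset: "smooth_on S f \<Longrightarrow> T \<subseteq> S \<Longrightarrow> smooth_on T f"
  unfolding smooth_on_def Ball_def Int_iff subset_iff by (elim all_forward) blast

lemma smooth_on_Union:
  assumes "\<And>V. V \<in> \<V> \<Longrightarrow> open V \<and> smooth_on V f"
  shows "smooth_on (\<Union>\<V>) f"
proof -
  have "Ck_on k f (\<Union>\<V>)" for k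
    using assms by (intro Ck_on_local) (metis UnionE smooth_on_open)
  then show ?thesis
    using assms by (simp add: smooth_on_open open_Union)
qed

lemma smooth_on_differentiable: "open U \<Longrightarrow> smooth_on U f \<Longrightarrow> x \<in> U \<Longrightarrow> f differentiable (at x)"
  using smooth_on_open[of U f] Ck_on.simps(2)[of 0 f U] by blast

lemma smooth_on_dderiv:
  assumes "open U" "smooth_on U f"
  shows "smooth_on U (\<lambda>x. dderiv f x v)"
proof -
  have "Ck_on (Suc k) f U" for k
    using assms unfolding smooth_on_open[OF assms(1)] by blast
  then show ?thesis
    by (simp add: smooth_on_open[OF assms(1)])
qed

lemma smooth_on_dderiv_commute:
  fixes f :: "'a::euclidean_space \<Rightarrow> 'b::real_inner"
  shows "open U \<Longrightarrow> smooth_on U f \<Longrightarrow> x \<in> U \<Longrightarrow>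
    dderiv (\<lambda>y. dderiv f y u) x v = dderiv (\<lambda>y. dderiv f y v) x u"
  unfolding smooth_on_open by (blast intro: dderiv_commute)

lemma smooth_on_const: "open U \<Longrightarrow> smooth_on U (\<lambda>x. c)"
  by (simp add: smooth_on_open Ck_on_const)

lemma smooth_on_bounded_linear: "open U \<Longrightarrow> bounded_linear L \<Longrightarrow> smooth_on U L"
  by (simp add: smooth_on_open Ck_on_bounded_linear)

lemma smooth_on_add:
  "open U \<Longrightarrow> smooth_on U f \<Longrightarrow> smooth_on U g \<Longrightarrow> smooth_on U (\<lambda>x. f x + g x)"
  by (simp add: smooth_on_open Ck_on_add)

lemma smooth_on_bilinear:
  "open U \<Longrightarrow> bounded_bilinear B \<Longrightarrow> smooth_on U f \<Longrightarrow> smooth_on U g \<Longrightarrow>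
    smooth_on U (\<lambda>x. B (f x) (g x))"
  by (simp add: smooth_on_open Ck_on_bilinear)

lemmas smooth_on_mult = smooth_on_bilinear[OF _ bounded_bilinear_mult]
lemmas smooth_on_scaleR = smooth_on_bilinear[OF _ bounded_bilinear_scaleR]

lemma smooth_on_linear_image:
  "open U \<Longrightarrow> bounded_linear L \<Longrightarrow> smooth_on U f \<Longrightarrow> smooth_on U (\<lambda>x. L (f x))"
  by (simp add: smooth_on_open Ck_on_linear_image)

lemma smooth_on_compose_affine:
  assumes "open U" "bounded_linear L" "smooth_on U f"
  shows "smooth_on {x. a + L x \<in> U} (\<lambda>x. f (a + L x))"
  using assms by (simp add: smooth_on_open open_affine_vimage Ck_on_compose_affine)

lemma smooth_on_inverse:
  fixes f :: "'a::euclidean_space \<Rightarrow> 'b::real_normed_field"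
  shows "open U \<Longrightarrow> smooth_on U f \<Longrightarrow> (\<And>x. x \<in> U \<Longrightarrow> f x \<noteq> 0) \<Longrightarrow>
    smooth_on U (\<lambda>x. inverse (f x))"
  by (simp add: smooth_on_open Ck_on_inverse)

section \<open>Holomorphic functions as smooth maps\<close>

lemma holomorphic_on_dderiv:
  assumes "open U" "f holomorphic_on U" "x \<in> U"
  shows "dderiv f x v = deriv f x * v"
  using holomorphic_derivI[OF assms(2,1,3)] by (simp add: dderiv_eq has_field_derivative_def)

text \<open>Directional derivatives \<open>deriv f x * v\<close> are again holomorphic, so the
  induction on the order never leaves the class.\<close>

lemma holomorphic_on_imp_smooth_on:
  assumes "open U" "f holomorphic_on U"
  shows "smooth_on U f"
proof -
  have "Ck_on k f U" for k
    using assms(2)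
  proof (induction k arbitrary: f)
    case 0
    then show ?case by (simp add: holomorphic_on_imp_continuous_on)
  next
    case (Suc k)
    have "f differentiable at x" if "x \<in> U" for x
      using holomorphic_derivI[OF Suc.prems assms(1) that]
      by (auto simp: has_field_derivative_def differentiable_def)
    moreover have "Ck_on k (\<lambda>x. dderiv f x v) U" for v
    proof (subst Ck_on_cong[OF assms(1) holomorphic_on_dderiv[OF assms(1) Suc.prems]])
      show "Ck_on k (\<lambda>x. deriv f x * v) U"
        using Suc.prems assms(1) by (intro Suc.IH holomorphic_intros)
    qed
    ultimately show ?case by simp
  qed
  with assms(1) show ?thesis by (simp add: smooth_on_open)
qed

section \<open>The hyperbolic metric\<close>

text \<open>The metric is a multiple of the Euclidean inner product, so raising an index multiplies
  by the inverse factor; nondegeneracy makes the description unique.\<close>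

lemma sharp_hyp_metric:
  assumes "Im p \<noteq> 0" "\<And>w. l w = X \<bullet> w"
  shows "sharp hyp_metric p l = (Im p)\<^sup>2 *\<^sub>R X"
  unfolding sharp_def
proof (rule the_equality)
  show "\<forall>w. hyp_metric p ((Im p)\<^sup>2 *\<^sub>R X) w = l w"
    using assms by (simp add: hyp_metric_def)
  fix Y assume Y: "\<forall>w. hyp_metric p Y w = l w"
  have "Y \<bullet> w = ((Im p)\<^sup>2 *\<^sub>R X) \<bullet> w" for w
    using spec[OF Y, of w] assms by (simp add: hyp_metric_def divide_eq_eq mult.commute)
  then show "Y = (Im p)\<^sup>2 *\<^sub>R X"
    using vector_eq_rdot by blast
qed

lemma dderiv_hyp_metric:
  assumes "Im p \<noteq> 0"
  shows "dderiv (\<lambda>q. hyp_metric q v w) p u = - (2 * Im u * (v \<bullet> w)) / (Im p) ^ 3"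
proof -
  have "((\<lambda>q. hyp_metric q v w) has_derivative (\<lambda>u. - (2 * Im u * (v \<bullet> w)) / (Im p) ^ 3)) (at p)"
    unfolding hyp_metric_def using assms
    by (auto intro!: derivative_eq_intros simp: fun_eq_iff field_simps power2_eq_square power3_eq_cube)
  then show ?thesis by (rule dderiv_eq)
qed

text \<open>The Christoffel symbols of the half plane in one complex formula: the three Koszul terms
  combine to the inner product of \<open>\<i> * u * v / y^3\<close> with \<open>w\<close>.\<close>

lemma christoffel_hyp_metric:
  assumes "Im p \<noteq> 0"
  shows "christoffel hyp_metric p u v = \<i> * u * v / of_real (Im p)"
proof -
  have "(dderiv (\<lambda>q. hyp_metric q v w) p u + dderiv (\<lambda>q. hyp_metric q u w) p v
      - dderiv (\<lambda>q. hyp_metric q u v) p w) / 2 = (\<i> * u * v / of_real ((Im p) ^ 3)) \<bullet> w" for w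
    using assms unfolding dderiv_hyp_metric[OF assms] inner_complex_def Re_divide_of_real Im_divide_of_real
    by (simp add: field_simps)
  from sharp_hyp_metric[OF assms this] show ?thesis
    unfolding christoffel_def using assms
    by (simp add: scaleR_conv_of_real power3_eq_cube power2_eq_square)
qed

lemma metric_trace_hyp_metric:
  assumes "Im p \<noteq> 0"
  shows "metric_trace hyp_metric p b = b 1 ((Im p)\<^sup>2 *\<^sub>R 1) + b \<i> ((Im p)\<^sup>2 *\<^sub>R \<i>)"
  unfolding metric_trace_def sharp_hyp_metric[OF assms refl]
  by (simp add: Basis_complex_def)

lemma dderiv_linear: "f differentiable (at p) \<Longrightarrow> linear (dderiv f p)"
  using has_derivative_dderiv has_derivative_linear by blast

lemma dderiv_scaleR_left:
  assumes "f differentiable (at p)"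
  shows "dderiv (\<lambda>q. c *\<^sub>R f q) p v = c *\<^sub>R dderiv f p v"
  using has_derivative_scaleR_right[OF has_derivative_dderiv[OF assms]] by (rule dderiv_eq)

text \<open>The Christoffel terms of the domain for the directions 1 and \<open>\<i>\<close> are
  opposite, since \<open>\<i> * \<i> = -1\<close>, and cancel in the trace; what remains is the flat
  Laplacian and the target term.\<close>

lemma tension_hyp_metric:
  assumes "open V" "p \<in> V" "smooth_on V \<phi>" "Im p \<noteq> 0" "Im (\<phi> p) \<noteq> 0"
  shows "tension hyp_metric hyp_metric \<phi> p = (Im p)\<^sup>2 *\<^sub>R
    (dderiv (\<lambda>q. dderiv \<phi> q 1) p 1 + dderiv (\<lambda>q. dderiv \<phi> q \<i>) p \<i>
     + ((dderiv \<phi> p 1)\<^sup>2 + (dderiv \<phi> p \<i>)\<^sup>2) * (\<i> / of_real (Im (\<phi> p))))"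
proof -
  have lin: "linear (dderiv \<phi> q)" if "q \<in> V" for q
    using assms that by (intro dderiv_linear smooth_on_differentiable)
  \<comment> \<open>The trace puts a multiple of a basis vector into the second slot of
    \<open>nabla_d\<close>, so the scalar must also be moved out from under the outer
    derivative.\<close>
  have sc: "dderiv (\<lambda>q. dderiv \<phi> q (c *\<^sub>R v)) p u = c *\<^sub>R dderiv (\<lambda>q. dderiv \<phi> q v) p u" for c u v
    using assms dderiv_cong[OF assms(1,2) linear_scale[OF lin]]
    by (simp add: dderiv_scaleR_left smooth_on_differentiable[OF _ smooth_on_dderiv])
  have pull: "\<i> * a * (c *\<^sub>R b) / d = c *\<^sub>R (\<i> * a * b / d)" for a b c d
    by (simp add: scaleR_conv_of_real)
  have tr: "nabla_d hyp_metric hyp_metric \<phi> p u (c *\<^sub>R v) = c *\<^sub>R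
      (dderiv (\<lambda>q. dderiv \<phi> q v) p u + \<i> * dderiv \<phi> p u * dderiv \<phi> p v / of_real (Im (\<phi> p))
       - dderiv \<phi> p (\<i> * u * v / of_real (Im p)))" for c u v
    unfolding nabla_d_def christoffel_hyp_metric[OF assms(4)] christoffel_hyp_metric[OF assms(5)]
      sc linear_scale[OF lin[OF assms(2)]] pull scaleR_add_right scaleR_diff_right ..
  have "dderiv \<phi> p (\<i> * 1 * 1 / of_real (Im p)) + dderiv \<phi> p (\<i> * \<i> * \<i> / of_real (Im p))
      = dderiv \<phi> p (\<i> * 1 * 1 / of_real (Im p) + \<i> * \<i> * \<i> / of_real (Im p))"
    by (rule linear_add[OF lin[OF assms(2)], symmetric])
  also have "\<dots> = 0"
    using linear_0[OF lin[OF assms(2)]] by simp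
  finally have eq: "dderiv \<phi> p (\<i> * \<i> * \<i> / of_real (Im p)) = - dderiv \<phi> p (\<i> * 1 * 1 / of_real (Im p))"
    by (simp add: eq_neg_iff_add_eq_0 add.commute)
  have alg: "x + \<i> * a * a / c - k + (y + \<i> * b * b / c - - k) = x + y + (a\<^sup>2 + b\<^sup>2) * (\<i> / c)"
    for x y a b c k :: complex
    by (simp add: power2_eq_square distrib_left distrib_right add_divide_distrib mult_ac)
  show ?thesis
    unfolding tension_def metric_trace_hyp_metric[OF assms(4)] tr scaleR_add_right[symmetric] eq alg ..
qed

text \<open>The tension at \<open>p\<close> depends only on the germ of the map, which allows a
  given family to be exchanged for a smooth extension of it.\<close>

lemma tension_cong:
  assumes "open V" "p \<in> V" "\<And>q. q \<in> V \<Longrightarrow> \<phi> q = \<psi> q"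
  shows "tension g h \<phi> p = tension g h \<psi> p"
proof -
  have "dderiv \<phi> q v = dderiv \<psi> q v" if "q \<in> V" for q v
    using assms(1) that assms(3) by (rule dderiv_cong)
  moreover from this have "dderiv (\<lambda>q. dderiv \<phi> q v) p u = dderiv (\<lambda>q. dderiv \<psi> q v) p u" for u v
    using assms by (intro dderiv_cong[OF assms(1,2)])
  ultimately show ?thesis
    using assms(2,3) by (simp add: tension_def nabla_d_def[abs_def])
qed

section \<open>The (2,0)-part of the Lie derivative\<close>

lemma dderiv_complex:
  assumes "\<xi> differentiable (at (p::complex))"
  shows "dderiv \<xi> p u = Re u *\<^sub>R dderiv \<xi> p 1 + Im u *\<^sub>R dderiv \<xi> p \<i>"
proof -
  note lin = dderiv_linear[OF assms]
  have "Re u *\<^sub>R 1 + Im u *\<^sub>R \<i> = u"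
    by (simp add: complex_eq_iff)
  then have "dderiv \<xi> p u = dderiv \<xi> p (Re u *\<^sub>R 1 + Im u *\<^sub>R \<i>)"
    by (rule arg_cong[OF sym])
  then show ?thesis
    by (simp only: linear_add[OF lin] linear_scale[OF lin])
qed

text \<open>Differentiating the conformal factor gives a multiple of the metric, which is pure trace
  and drops out. The rest has the entries \<open>Re A - Im B\<close> and \<open>Im A + Re B\<close>
  as its trace-free part, up to the factor \<open>1 / y\<^sup>2\<close>.\<close>

lemma part20_lie_hyp_metric:
  assumes "\<xi> differentiable (at p)" "Im p \<noteq> 0"
  shows "part20 hyp_metric p (lie_metric hyp_metric \<xi> p)
    = cnj (dderiv \<xi> p 1 + \<i> * dderiv \<xi> p \<i>) / of_real ((Im p)\<^sup>2)"
proof -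
  define A where "A = dderiv \<xi> p 1"
  define B where "B = dderiv \<xi> p \<i>"
  have lie: "lie_metric hyp_metric \<xi> p u v = - (2 * Im (\<xi> p) * (u \<bullet> v)) / (Im p) ^ 3
     + ((Re u *\<^sub>R A + Im u *\<^sub>R B) \<bullet> v + u \<bullet> (Re v *\<^sub>R A + Im v *\<^sub>R B)) / (Im p)\<^sup>2" for u v
    unfolding lie_metric_def dderiv_hyp_metric[OF assms(2)] A_def B_def
      dderiv_complex[OF assms(1), symmetric]
    by (simp add: hyp_metric_def add_divide_distrib)
  let ?f = "cnj (A + \<i> * B) / of_real ((Im p)\<^sup>2)"
  have tf: "trace_free hyp_metric p (lie_metric hyp_metric \<xi> p) u v = Re (?f * u * v)" for u v
    using assms(2) unfolding trace_free_def metric_trace_hyp_metric[OF assms(2)] lie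
    by (simp add: hyp_metric_def inner_complex_def Re_divide_of_real Im_divide_of_real
        power2_eq_square power3_eq_cube divide_simps) (simp add: algebra_simps)
  \<comment> \<open>Evaluation at \<open>(1, 1)\<close> gives \<open>Re f\<close>, and at
    \<open>(1, \<i>)\<close> it gives \<open>- Im f\<close>.\<close>
  have "f = ?f" if "\<forall>u v. Re (?f * u * v) = Re (f * u * v)" for f
    using that[THEN spec, of 1, THEN spec, of 1] that[THEN spec, of 1, THEN spec, of \<i>]
    using assms(2) by (auto simp: complex_eq_iff field_simps)
  then show ?thesis
    unfolding part20_def tf A_def[symmetric] B_def[symmetric] by (intro the_equality) auto
qed

section \<open>The linearised tension field\<close>

text \<open>Up to sign and the factor \<open>(Im p)\<^sup>2\<close>, this is the Jacobi operator of
  the identity map of the half plane.\<close>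

definition jacobi :: "(complex \<Rightarrow> complex) \<Rightarrow> complex \<Rightarrow> complex" where
  "jacobi \<xi> p = dderiv (\<lambda>q. dderiv \<xi> q 1) p 1 + dderiv (\<lambda>q. dderiv \<xi> q \<i>) p \<i>
     + 2 * (dderiv \<xi> p 1 + \<i> * dderiv \<xi> p \<i>) * (\<i> / of_real (Im p))"

section \<open>Time and space derivatives of a family of maps\<close>

lemma slice:
  assumes "open W" "smooth_on W G"
  shows open_slice: "open {q. (t, q) \<in> W}"
    and smooth_on_slice: "smooth_on {q. (t, q) \<in> W} (\<lambda>q. G (t, q))"
  using open_affine_vimage[OF assms(1), of "Pair 0" "(t, 0)"]
    smooth_on_compose_affine[OF assms(1) _ assms(2), of "Pair 0" "(t, 0)"]
  by (simp_all add: bounded_linear_Pair bounded_linear_zero bounded_linear_ident)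

text \<open>Spatial derivatives become directional derivatives of one map on the product space, so
  that exchanging them with the time derivative is an instance of the symmetry of second
  derivatives.\<close>

lemma dderiv_slice:
  assumes "G differentiable (at (t, p))"
  shows "dderiv (\<lambda>q. G (t, q)) p v = dderiv G (t, p) (0, v)"
proof (rule dderiv_eq)
  have "((\<lambda>q. (t, q)) has_derivative (\<lambda>v. (0, v))) (at p)"
    by (intro has_derivative_Pair has_derivative_const has_derivative_ident)
  from this has_derivative_dderiv[OF assms]
  show "((\<lambda>q. G (t, q)) has_derivative (\<lambda>v. dderiv G (t, p) (0, v))) (at p)"
    by (rule has_derivative_compose)
qed

lemma vector_derivative_time:
  assumes "G differentiable (at (t, p))"
  shows "((\<lambda>t. G (t, p)) has_vector_derivative dderiv G (t, p) (1, 0)) (at t)"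
proof -
  have "((\<lambda>t. (t, p)) has_derivative (\<lambda>h. (h, 0))) (at t)"
    by (intro has_derivative_Pair has_derivative_const has_derivative_ident)
  from this has_derivative_dderiv[OF assms]
  have "((\<lambda>t. G (t, p)) has_derivative (\<lambda>h. dderiv G (t, p) (h, 0))) (at t)"
    by (rule has_derivative_compose)
  moreover have "(\<lambda>h. dderiv G (t, p) (h, 0)) = (\<lambda>h. h *\<^sub>R dderiv G (t, p) (1, 0))"
  proof
    fix h :: real
    show "dderiv G (t, p) (h, 0) = h *\<^sub>R dderiv G (t, p) (1, 0)"
      using linear_scale[OF dderiv_linear[OF assms], of h "(1, 0)"] by simp
  qed
  ultimately show ?thesis
    unfolding has_vector_derivative_def by (simp only:)
qed

text \<open>At the identity \<open>\<phi>\<^sub>x\<^sup>2 + \<phi>\<^sub>y\<^sup>2 = 0\<close>, so the variation of \<open>Im \<phi>\<close> does not contribute.\<close>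

lemma tension_variation:
  fixes G :: "real \<times> complex \<Rightarrow> complex"
  assumes W: "open W" "smooth_on W G" and z: "(0, z) \<in> W" "Im z \<noteq> 0"
    and G0: "\<And>q. (0, q) \<in> W \<Longrightarrow> G (0, q) = q"
    and G1: "\<And>q. (0, q) \<in> W \<Longrightarrow> dderiv G (0, q) (1, 0) = \<xi> q"
  shows "((\<lambda>t. tension hyp_metric hyp_metric (\<lambda>q. G (t, q)) z) has_vector_derivative
           (Im z)\<^sup>2 *\<^sub>R jacobi \<xi> z) (at 0)"
proof -
  \<comment> \<open>First and repeated second space derivatives as functions of time and space
    jointly, so that they can be differentiated in time.\<close>
  define D where "D = (\<lambda>v P. dderiv G P (0, v))"
  define DD where "DD = (\<lambda>v P. dderiv (D v) P (0, v))"
  have sD: "smooth_on W (D v)" for v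
    unfolding D_def using W by (rule smooth_on_dderiv)
  have sDD: "smooth_on W (DD v)" for v
    unfolding DD_def using W(1) sD by (rule smooth_on_dderiv)
  note diff = smooth_on_differentiable[OF W(1)]
  define S where "S = {q. (0, q) \<in> W}"
  have S: "open S" "z \<in> S"
    using open_slice[OF W] z by (auto simp: S_def)
  have slice1: "dderiv (\<lambda>q. G (t, q)) q v = D v (t, q)" if "(t, q) \<in> W" for t q v
    unfolding D_def by (rule dderiv_slice[OF diff[OF W(2) that]])
  have slice2: "dderiv (\<lambda>q. dderiv (\<lambda>q. G (t, q)) q v) z v = DD v (t, z)" if "(t, z) \<in> W" for t v
  proof -
    have "dderiv (\<lambda>q. dderiv (\<lambda>q. G (t, q)) q v) z v = dderiv (\<lambda>q. D v (t, q)) z v"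
      using that slice1 by (intro dderiv_cong[OF open_slice[OF W, of t]]) auto
    also have "\<dots> = DD v (t, z)"
      unfolding DD_def by (rule dderiv_slice[OF diff[OF sD that]])
    finally show ?thesis .
  qed
  let ?R = "\<lambda>t. \<i> / of_real (Im (G (t, z)))"
  let ?T = "\<lambda>t. (Im z)\<^sup>2 *\<^sub>R (DD 1 (t, z) + DD \<i> (t, z) + ((D 1 (t, z))\<^sup>2 + (D \<i> (t, z))\<^sup>2) * ?R t)"
  have tens: "tension hyp_metric hyp_metric (\<lambda>q. G (t, q)) z = ?T t"
    if "(t, z) \<in> W" "Im (G (t, z)) \<noteq> 0" for t
    using tension_hyp_metric[OF open_slice[OF W, of t] _ smooth_on_slice[OF W] z(2)] that
    by (simp add: slice1 slice2)
  have Dt: "((\<lambda>t. H (t, z)) has_vector_derivative dderiv H (0, z) (1, 0)) (at 0)"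
    if "smooth_on W H" for H :: "real \<times> complex \<Rightarrow> complex"
    by (rule vector_derivative_time[OF diff[OF that z(1)]])
  have D0: "D v (0, z) = v" for v
  proof -
    have "D v (0, z) = dderiv (\<lambda>q. G (0, q)) z v"
      using slice1[OF z(1)] by simp
    also have "\<dots> = dderiv (\<lambda>q. q) z v"
      using G0 by (intro dderiv_cong[OF S]) (simp add: S_def)
    also have "\<dots> = v"
      by (rule dderiv_eq[OF has_derivative_ident])
    finally show ?thesis .
  qed
  have D1: "dderiv (D v) P (1, 0) = dderiv (\<lambda>P. dderiv G P (1, 0)) P (0, v)" if "P \<in> W" for v P
    unfolding D_def using W that by (rule smooth_on_dderiv_commute)
  have st: "smooth_on W (\<lambda>P. dderiv G P (1, 0))"
    using W by (rule smooth_on_dderiv)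
  have D1S: "dderiv (\<lambda>P. dderiv G P (1, 0)) (0, q) (0, v) = dderiv \<xi> q v" if "q \<in> S" for q v
  proof -
    have q: "(0, q) \<in> W" using that by (simp add: S_def)
    have "dderiv (\<lambda>P. dderiv G P (1, 0)) (0, q) (0, v) = dderiv (\<lambda>q. dderiv G (0, q) (1, 0)) q v"
      by (rule dderiv_slice[OF diff[OF st q], symmetric])
    also have "\<dots> = dderiv \<xi> q v"
      using G1 by (intro dderiv_cong[OF S(1) that]) (simp add: S_def)
    finally show ?thesis .
  qed
  have DtD: "dderiv (D v) (0, z) (1, 0) = dderiv \<xi> z v" for v
    using D1[OF z(1)] D1S[OF S(2)] by simp
  \<comment> \<open>The time derivative is moved past the two space derivatives one at a time; at
    time 0 it turns \<open>G\<close> into \<open>\<xi>\<close>.\<close>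
  have DtDD: "dderiv (DD v) (0, z) (1, 0) = dderiv (\<lambda>q. dderiv \<xi> q v) z v" for v
  proof -
    let ?E = "\<lambda>P. dderiv (\<lambda>P. dderiv G P (1, 0)) P (0, v)"
    have "dderiv (DD v) (0, z) (1, 0) = dderiv (\<lambda>P. dderiv (D v) P (1, 0)) (0, z) (0, v)"
      unfolding DD_def using W(1) sD z(1) by (rule smooth_on_dderiv_commute)
    also have "\<dots> = dderiv ?E (0, z) (0, v)"
      by (rule dderiv_cong[OF W(1) z(1) D1])
    also have "\<dots> = dderiv (\<lambda>q. ?E (0, q)) z v"
      by (rule dderiv_slice[OF diff[OF smooth_on_dderiv[OF W(1) st] z(1)], symmetric])
    also have "\<dots> = dderiv (\<lambda>q. dderiv \<xi> q v) z v"
      by (rule dderiv_cong[OF S D1S])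
    finally show ?thesis .
  qed
  have cont: "((\<lambda>t. G (t, z)) \<longlongrightarrow> z) (at 0)"
    using has_vector_derivative_continuous[OF Dt[OF W(2)]] G0[OF z(1)] by (simp add: isCont_def)
  \<comment> \<open>Only the existence of a derivative is established: its coefficient
    \<open>1\<^sup>2 + \<i>\<^sup>2\<close> vanishes.\<close>
  have "?R differentiable (at 0)"
  proof -
    have "(\<lambda>t. G (t, z)) differentiable (at 0)"
      using Dt[OF W(2)] by (auto simp: has_vector_derivative_def differentiable_def)
    then have "(\<lambda>t. complex_of_real (Im (G (t, z)))) differentiable (at 0)"
      unfolding differentiable_def
      using bounded_linear.has_derivative[OF bounded_linear_compose[OF bounded_linear_of_real bounded_linear_Im]]
      by blast
    then show ?thesis
      using G0[OF z(1)] z(2) by (intro differentiable_divide) auto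
  qed
  then obtain R' where R': "(?R has_vector_derivative R') (at 0)"
    using vector_derivative_works by blast
  have "(?T has_vector_derivative (Im z)\<^sup>2 *\<^sub>R (dderiv (DD 1) (0, z) (1, 0) + dderiv (DD \<i>) (0, z) (1, 0)
      + (((D 1 (0, z))\<^sup>2 + (D \<i> (0, z))\<^sup>2) * R' + ((D 1 (0, z) * dderiv (D 1) (0, z) (1, 0) + dderiv (D 1) (0, z) (1, 0) * D 1 (0, z))
         + (D \<i> (0, z) * dderiv (D \<i>) (0, z) (1, 0) + dderiv (D \<i>) (0, z) (1, 0) * D \<i> (0, z))) * ?R 0))) (at 0)"
    unfolding power2_eq_square[of "D _ _"]
    by (intro bounded_linear.has_vector_derivative[OF bounded_linear_scaleR_right]
        has_vector_derivative_add has_vector_derivative_mult Dt sD sDD R')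
  moreover have "(Im z)\<^sup>2 *\<^sub>R (dderiv (DD 1) (0, z) (1, 0) + dderiv (DD \<i>) (0, z) (1, 0)
      + (((D 1 (0, z))\<^sup>2 + (D \<i> (0, z))\<^sup>2) * R' + ((D 1 (0, z) * dderiv (D 1) (0, z) (1, 0) + dderiv (D 1) (0, z) (1, 0) * D 1 (0, z))
         + (D \<i> (0, z) * dderiv (D \<i>) (0, z) (1, 0) + dderiv (D \<i>) (0, z) (1, 0) * D \<i> (0, z))) * ?R 0))
      = (Im z)\<^sup>2 *\<^sub>R jacobi \<xi> z"
    unfolding D0 DtD DtDD G0[OF z(1)] jacobi_def by (simp add: algebra_simps)
  ultimately have T: "(?T has_vector_derivative (Im z)\<^sup>2 *\<^sub>R jacobi \<xi> z) (at 0)"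
    by (rule back_subst)
  \<comment> \<open>The coordinate formula \<open>?T\<close> for the tension requires
    \<open>z\<close> in the slice and \<open>Im (G (t, z))\<close> nonzero; both hold for small
    \<open>t\<close>.\<close>
  have "\<forall>\<^sub>F t in nhds 0. (t, z) \<in> W \<and> Im (G (t, z)) \<noteq> 0"
  proof (rule eventually_conj)
    have "open {t. (t, z) \<in> W}"
      using open_affine_vimage[OF W(1), of "\<lambda>t. (t, 0)" "(0, z)"]
      by (simp add: bounded_linear_Pair bounded_linear_zero bounded_linear_ident)
    then show "\<forall>\<^sub>F t in nhds 0. (t, z) \<in> W"
      using z(1) eventually_nhds_in_open[of "{t. (t, z) \<in> W}" 0] by simp
    have "((\<lambda>t. G (t, z)) \<longlongrightarrow> G (0, z)) (nhds 0)"
      using cont G0[OF z(1)] tendsto_at_iff_tendsto_nhds[of "\<lambda>t. G (t, z)" 0] by simp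
    from tendsto_Im[OF this] show "\<forall>\<^sub>F t in nhds 0. Im (G (t, z)) \<noteq> 0"
      using z(2) G0[OF z(1)] by (intro tendsto_imp_eventually_ne) auto
  qed
  then obtain d where d: "d > 0" "\<And>t. dist t 0 < d \<Longrightarrow> (t, z) \<in> W \<and> Im (G (t, z)) \<noteq> 0"
    unfolding eventually_nhds_metric by blast
  show ?thesis
    by (rule has_vector_derivative_transform_within[OF T d(1)]) (use d(2) tens in auto)
qed

section \<open>Cauchy-Riemann equations and the coefficient of the quadratic differential\<close>

text \<open>The real derivative is determined by its values at 1 and \<open>\<i>\<close>; the
  equation says exactly that it is multiplication by its value at 1.\<close>

lemma holomorphic_on_iff_Cauchy_Riemann:
  assumes "open U" "\<And>z. z \<in> U \<Longrightarrow> f differentiable (at z)"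
  shows "f holomorphic_on U \<longleftrightarrow> (\<forall>z\<in>U. dderiv f z 1 + \<i> * dderiv f z \<i> = 0)"
proof
  assume f: "f holomorphic_on U"
  have "dderiv f z 1 + \<i> * dderiv f z \<i> = 0" if "z \<in> U" for z
    unfolding holomorphic_on_dderiv[OF assms(1) f that] by (simp add: complex_eq_iff)
  then show "\<forall>z\<in>U. dderiv f z 1 + \<i> * dderiv f z \<i> = 0"
    by blast
next
  assume CR: "\<forall>z\<in>U. dderiv f z 1 + \<i> * dderiv f z \<i> = 0"
  have "(f has_field_derivative dderiv f z 1) (at z)" if "z \<in> U" for z
  proof -
    have "\<i> * (dderiv f z 1 + \<i> * dderiv f z \<i>) = 0"
      using CR that by simp
    then have i: "dderiv f z \<i> = \<i> * dderiv f z 1"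
      by (simp add: distrib_left flip: mult.assoc)
    have "dderiv f z u = dderiv f z 1 * u" for u
    proof -
      have "dderiv f z u = dderiv f z 1 * (Re u *\<^sub>R 1 + Im u *\<^sub>R \<i>)"
        by (subst dderiv_complex[OF assms(2)[OF that]])
           (simp add: i scaleR_conv_of_real algebra_simps)
      also have "Re u *\<^sub>R 1 + Im u *\<^sub>R \<i> = u"
        by (simp add: complex_eq_iff)
      finally show ?thesis .
    qed
    then have "dderiv f z = (*) (dderiv f z 1)"
      by blast
    then show ?thesis
      using has_derivative_dderiv[OF assms(2)[OF that]] by (simp add: has_field_derivative_def)
  qed
  then show "f holomorphic_on U"
    using assms(1) holomorphic_on_open by blast
qed

text \<open>For differentiable \<open>\<xi>\<close> this is the value of \<open>part20\<close> found
  above, that is, \<open>2 / y\<^sup>2\<close> times the conjugate of the derivative of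
  \<open>\<xi>\<close> with respect to \<open>cnj z\<close>. It is written as a product to suit the
  product rule.\<close>

definition quad_coeff :: "(complex \<Rightarrow> complex) \<Rightarrow> complex \<Rightarrow> complex" where
  "quad_coeff \<xi> p = cnj (dderiv \<xi> p 1 + \<i> * dderiv \<xi> p \<i>) * of_real (inverse ((Im p)\<^sup>2))"

lemma quad_coeff_cong:
  assumes "open U" "p \<in> U" "\<And>q. q \<in> U \<Longrightarrow> \<xi> q = \<eta> q"
  shows "quad_coeff \<xi> p = quad_coeff \<eta> p"
  by (simp add: quad_coeff_def dderiv_cong[OF assms])

lemma quad_coeff_add:
  assumes "\<xi> differentiable (at p)" "\<eta> differentiable (at p)"
  shows "quad_coeff (\<lambda>q. \<xi> q + \<eta> q) p = quad_coeff \<xi> p + quad_coeff \<eta> p"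
  using dderiv_eq[OF has_derivative_add[OF assms[THEN has_derivative_dderiv]]]
  by (simp add: quad_coeff_def algebra_simps)

lemma quad_coeff_scaleR:
  assumes "\<xi> differentiable (at p)"
  shows "quad_coeff (\<lambda>q. c *\<^sub>R \<xi> q) p = c *\<^sub>R quad_coeff \<xi> p"
  unfolding quad_coeff_def dderiv_scaleR_left[OF assms]
  by (simp add: scaleR_conv_of_real algebra_simps)

lemma quad_coeff_zero: "quad_coeff (\<lambda>q. 0) p = 0"
proof -
  have "dderiv (\<lambda>q::complex. 0::complex) p v = 0" for v
    using has_derivative_const by (rule dderiv_eq)
  then show ?thesis by (simp add: quad_coeff_def)
qed

text \<open>Applying \<open>d/dx + \<i> * d/dy\<close> to \<open>quad_coeff \<xi>\<close> gives
  \<open>cnj (jacobi \<xi>) / y\<^sup>2\<close>: the mixed second derivatives cancel by symmetry,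
  leaving the Laplacian, and differentiating \<open>1 / y\<^sup>2\<close> yields the first-order
  term.\<close>

lemma holomorphic_quad_coeff_iff:
  assumes U: "open U" "U \<subseteq> H2" and \<xi>: "smooth_on U \<xi>"
  shows "quad_coeff \<xi> holomorphic_on U \<longleftrightarrow> (\<forall>z\<in>U. jacobi \<xi> z = 0)"
proof -
  let ?w = "\<lambda>p. dderiv \<xi> p 1 + \<i> * dderiv \<xi> p \<i>"
  have sm: "smooth_on U (\<lambda>p. dderiv \<xi> p v)" for v
    using U(1) \<xi> by (rule smooth_on_dderiv)
  have D: "(quad_coeff \<xi> has_derivative (\<lambda>v. cnj (?w z) * of_real (- (2 * Im v / (Im z) ^ 3))
      + cnj (dderiv (\<lambda>p. dderiv \<xi> p 1) z v + \<i> * dderiv (\<lambda>p. dderiv \<xi> p \<i>) z v)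
        * of_real (inverse ((Im z)\<^sup>2)))) (at z)" if "z \<in> U" for z
  proof -
    have y: "Im z \<noteq> 0"
      using that U(2) by (auto simp: H2_def)
    have "((\<lambda>p. inverse ((Im p)\<^sup>2)) has_derivative (\<lambda>v. - (2 * Im v / (Im z) ^ 3))) (at z)"
      using y by (auto intro!: derivative_eq_intros simp: fun_eq_iff field_simps power2_eq_square power3_eq_cube)
    moreover have "(?w has_derivative (\<lambda>v. dderiv (\<lambda>p. dderiv \<xi> p 1) z v + \<i> * dderiv (\<lambda>p. dderiv \<xi> p \<i>) z v)) (at z)"
      by (intro has_derivative_add has_derivative_mult_right has_derivative_dderiv
          smooth_on_differentiable[OF U(1) sm that])
    ultimately show ?thesis
      unfolding quad_coeff_def
      by (intro has_derivative_mult has_derivative_of_real has_derivative_cnj)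
  qed
  have "dderiv (quad_coeff \<xi>) z 1 + \<i> * dderiv (quad_coeff \<xi>) z \<i>
      = cnj (jacobi \<xi> z) * of_real (inverse ((Im z)\<^sup>2))" if "z \<in> U" for z
  proof -
    have y: "Im z \<noteq> 0"
      using that U(2) by (auto simp: H2_def)
    have "dderiv (\<lambda>p. dderiv \<xi> p 1) z \<i> = dderiv (\<lambda>p. dderiv \<xi> p \<i>) z 1"
      using U(1) \<xi> that by (rule smooth_on_dderiv_commute)
    moreover have "of_real (- (2 * Im \<i> / (Im z) ^ 3)) = - 2 * inverse (complex_of_real (Im z)) * of_real (inverse ((Im z)\<^sup>2))"
      by (simp add: power3_eq_cube power2_eq_square divide_inverse)
    moreover have "of_real (- (2 * Im 1 / (Im z) ^ 3)) = (0::complex)"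
      by simp
    ultimately show ?thesis
      unfolding dderiv_eq[OF D[OF that]] jacobi_def
      by (simp add: algebra_simps divide_inverse)
  qed
  moreover have "Im z \<noteq> 0" if "z \<in> U" for z
    using that U(2) by (auto simp: H2_def)
  ultimately have "(\<forall>z\<in>U. dderiv (quad_coeff \<xi>) z 1 + \<i> * dderiv (quad_coeff \<xi>) z \<i> = 0)
      \<longleftrightarrow> (\<forall>z\<in>U. jacobi \<xi> z = 0)"
    by simp
  moreover have "quad_coeff \<xi> differentiable (at z)" if "z \<in> U" for z
    using D[OF that] by (auto simp: differentiable_def)
  ultimately show ?thesis
    using holomorphic_on_iff_Cauchy_Riemann[OF U(1)] by blast
qed

section \<open>Harmonic vector fields\<close>

text \<open>The family is given for nonnegative times only, so near \<open>(0, z)\<close> it is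
  replaced by a smooth extension \<open>G\<close>, to which \<open>tension_variation\<close>
  applies. Uniqueness of one-sided derivatives then compares the result with the assumed value
  0.\<close>

lemma harmonic_field_imp_jacobi:
  assumes U: "open U" "U \<subseteq> H2" and har: "harmonic_field U \<xi>" and z: "z \<in> U"
  shows "jacobi \<xi> z = 0"
proof -
  from har obtain \<epsilon> \<phi> where e: "\<epsilon> > 0"
    and sm: "smooth_on ({0..<\<epsilon>} \<times> U) (\<lambda>(t, z). \<phi> t z)"
    and p0: "\<And>z. z \<in> U \<Longrightarrow> \<phi> 0 z = z"
    and p1: "\<And>z. z \<in> U \<Longrightarrow> ((\<lambda>t. \<phi> t z) has_vector_derivative \<xi> z) (at 0 within {0..<\<epsilon>})"
    and p2: "\<And>z. z \<in> U \<Longrightarrow> ((\<lambda>t. tension hyp_metric hyp_metric (\<phi> t) z) has_vector_derivative 0)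
                  (at 0 within {0..<\<epsilon>})"
    unfolding harmonic_field_def by blast
  have "(0, z) \<in> {0..<\<epsilon>} \<times> U"
    using e z by auto
  with sm obtain V G where V: "open V" "(0, z) \<in> V" and Ck: "\<And>k. Ck_on k G V"
    and G: "\<And>P. P \<in> ({0..<\<epsilon>} \<times> U) \<inter> V \<Longrightarrow> G P = (case P of (t, z) \<Rightarrow> \<phi> t z)"
    unfolding smooth_on_def by meson
  \<comment> \<open>Space points are kept in \<open>U\<close>, so that \<open>G\<close> agrees with
    the family at every point of \<open>W\<close> whose time lies in the interval.\<close>
  define W where "W = V \<inter> (UNIV \<times> U)"
  have W: "open W" "(0, z) \<in> W"
    using V U(1) z by (auto simp: W_def open_Times open_Int)
  have WG: "smooth_on W G"
    using Ck_on_subset[OF Ck] W(1) by (simp add: smooth_on_open W_def)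
  have GW: "G (t, q) = \<phi> t q" if "(t, q) \<in> W" "t \<in> {0..<\<epsilon>}" for t q
    using G[of "(t, q)"] that by (auto simp: W_def)
  \<comment> \<open>Time 0 is a limit point of the half-open interval, which makes derivatives
    within it unique.\<close>
  have bot: "at 0 within {0..<\<epsilon>} \<noteq> bot"
    using e by (simp add: trivial_limit_within islimpt_greaterThanLessThan1 at_within_eq_bot_iff)
  have near: "\<exists>d>0. \<forall>t\<in>{0..<\<epsilon>}. dist t 0 < d \<longrightarrow> (t, q) \<in> W" if q: "(0, q) \<in> W" for q
  proof -
    have "open {t. (0, q) + (t, 0) \<in> W}"
      using open_affine_vimage[OF W(1), of "\<lambda>t. (t, 0)" "(0, q)"]
      by (simp add: bounded_linear_Pair bounded_linear_zero bounded_linear_ident)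
    then obtain d where "d > 0" "ball 0 d \<subseteq> {t. (0, q) + (t, 0) \<in> W}"
      using q open_contains_ball[of "{t. (0, q) + (t, 0) \<in> W}"] by force
    then show ?thesis
      by (intro exI[of _ d]) (auto simp: dist_commute subset_iff)
  qed
  have G0: "G (0, q) = q" if "(0, q) \<in> W" for q
    using GW[OF that] e p0 that by (auto simp: W_def)
  have G1: "dderiv G (0, q) (1, 0) = \<xi> q" if q: "(0, q) \<in> W" for q
  proof -
    from near[OF q] obtain d where d: "d > 0" "\<And>t. t \<in> {0..<\<epsilon>} \<Longrightarrow> dist t 0 < d \<Longrightarrow> (t, q) \<in> W"
      by blast
    have 1: "((\<lambda>t. G (t, q)) has_vector_derivative \<xi> q) (at 0 within {0..<\<epsilon>})"
      using q e d(2) GW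
      by (intro has_vector_derivative_transform_within[OF p1 d(1)]) (auto simp: W_def)
    have 2: "((\<lambda>t. G (t, q)) has_vector_derivative dderiv G (0, q) (1, 0)) (at 0 within {0..<\<epsilon>})"
      by (rule has_vector_derivative_at_within[OF vector_derivative_time[OF
            smooth_on_differentiable[OF W(1) WG q]]])
    show ?thesis
      by (rule vector_derivative_unique_within[OF bot 2 1])
  qed
  from near[OF W(2)] obtain d where d: "d > 0" "\<And>t. t \<in> {0..<\<epsilon>} \<Longrightarrow> dist t 0 < d \<Longrightarrow> (t, z) \<in> W"
    by blast
  have y: "Im z \<noteq> 0"
    using z U(2) by (auto simp: H2_def)
  have "((\<lambda>t. tension hyp_metric hyp_metric (\<phi> t) z) has_vector_derivative
      (Im z)\<^sup>2 *\<^sub>R jacobi \<xi> z)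
      (at 0 within {0..<\<epsilon>})"
  proof (rule has_vector_derivative_transform_within[OF _ d(1)])
    show "((\<lambda>t. tension hyp_metric hyp_metric (\<lambda>q. G (t, q)) z) has_vector_derivative
        (Im z)\<^sup>2 *\<^sub>R jacobi \<xi> z) (at 0 within {0..<\<epsilon>})"
      by (rule has_vector_derivative_at_within[OF tension_variation[OF W(1) WG W(2) y G0 G1]])
    show "0 \<in> {0..<\<epsilon>}"
      using e by simp
    show "tension hyp_metric hyp_metric (\<lambda>q. G (t, q)) z = tension hyp_metric hyp_metric (\<phi> t) z"
      if "t \<in> {0..<\<epsilon>}" "dist t 0 < d" for t
      using d(2)[OF that] GW[OF _ that(1)] by (intro tension_cong[OF open_slice[OF W(1) WG, of t]]) auto
  qed
  from vector_derivative_unique_within[OF bot this p2[OF z]]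
  have "(Im z)\<^sup>2 *\<^sub>R jacobi \<xi> z = 0" .
  with y show ?thesis by simp
qed

text \<open>The flow line of \<open>\<xi>\<close> leaves the half plane in finite time. The second-order term keeps the
  variation inside it, because \<open>1 + s + s\<^sup>2 > 0\<close> for all real \<open>s\<close>.\<close>

lemma jacobi_imp_harmonic_field:
  assumes U: "open U" "U \<subseteq> H2" and \<xi>: "smooth_on U \<xi>"
    and jac: "\<And>z. z \<in> U \<Longrightarrow> jacobi \<xi> z = 0"
  shows "harmonic_field U \<xi>"
proof -
  \<comment> \<open>With \<open>s = t * Im (\<xi> z) / Im z\<close> this choice gives
    \<open>Im (G (t, z)) = Im z * (1 + s + s\<^sup>2)\<close>. Being multiplied by
    \<open>t\<^sup>2\<close>, it leaves the initial velocity \<open>\<xi>\<close> unchanged.\<close>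
  define K where "K = (\<lambda>z. \<i> * complex_of_real (Im (\<xi> z) * Im (\<xi> z) * inverse (Im z)))"
  define G where "G = (\<lambda>P::real \<times> complex. snd P + fst P *\<^sub>R \<xi> (snd P) + (fst P * fst P) *\<^sub>R K (snd P))"
  have y: "Im z > 0" if "z \<in> U" for z
    using that U(2) by (auto simp: H2_def)
  have K: "smooth_on U K"
    unfolding K_def
    using y by (intro smooth_on_mult smooth_on_const smooth_on_linear_image[of U complex_of_real]
        smooth_on_inverse smooth_on_linear_image[of U Im] smooth_on_bounded_linear
        U(1) \<xi> bounded_linear_Im bounded_linear_of_real) force+
  define W where "W = (UNIV :: real set) \<times> U"
  have W: "open W"
    using U(1) by (simp add: W_def open_Times)
  have snd: "smooth_on W (\<lambda>P. h (snd P))" if "smooth_on U h" for h :: "complex \<Rightarrow> complex"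
  proof -
    have "W = {P. 0 + snd P \<in> U}"
      by (auto simp: W_def)
    then show ?thesis
      using smooth_on_compose_affine[OF U(1) bounded_linear_snd that, of 0] by simp
  qed
  have fst: "smooth_on W (fst :: real \<times> complex \<Rightarrow> real)"
    using W bounded_linear_fst by (rule smooth_on_bounded_linear)
  have G: "smooth_on W G"
    unfolding G_def
    by (intro smooth_on_add smooth_on_scaleR smooth_on_mult W fst snd \<xi> K
        smooth_on_bounded_linear bounded_linear_snd)
  have G0: "G (0, q) = q" for q
    by (simp add: G_def)
  have time: "((\<lambda>t. G (t, q)) has_vector_derivative \<xi> q) (at 0)" for q
    unfolding G_def by (auto intro!: derivative_eq_intros)
  have G1: "dderiv G (0, q) (1, 0) = \<xi> q" if "(0, q) \<in> W" for q
    using vector_derivative_unique_at[OF vector_derivative_time[OF smooth_on_differentiable[OF W G that]] time] .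
  have "Im (G (t, z)) > 0" if "z \<in> U" for t z
  proof -
    let ?s = "t * Im (\<xi> z) / Im z"
    have "Im (G (t, z)) = Im z * (1 + ?s + ?s * ?s)"
      using y[OF that] by (simp add: G_def K_def field_simps)
    moreover have "1 + s + s * s > 0" for s :: real
    proof -
      have "1 + s + s * s = (s + 1/2)\<^sup>2 + 3/4"
        by (simp add: power2_eq_square algebra_simps)
      then show ?thesis by (simp add: add_nonneg_pos)
    qed
    ultimately show ?thesis
      using y[OF that] by (metis mult_pos_pos)
  qed
  moreover have "((\<lambda>t. tension hyp_metric hyp_metric (\<lambda>q. G (t, q)) z) has_vector_derivative 0) (at 0)"
    if "z \<in> U" for z
    using tension_variation[OF W G, of z \<xi>] y[OF that] G0 G1 that jac by (simp add: W_def)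
  moreover have "smooth_on ({0..<1} \<times> U) G"
    using G by (rule smooth_on_subset) (auto simp: W_def)
  \<comment> \<open>The bound 1 for the time is arbitrary, as \<open>G\<close> stays in the half
    plane for all \<open>t\<close>.\<close>
  ultimately show ?thesis
    unfolding harmonic_field_def using \<xi> G0 time
    by (intro conjI exI[of _ "1::real"] exI[of _ "\<lambda>t z. G (t, z)"])
       (auto simp: H2_def intro: has_vector_derivative_at_within)
qed

text \<open>The definition quantifies over variations, for which sums and gluings are not evident;
  the right-hand side is local and stable under real linear combinations, as the sheaf axioms
  demand.\<close>

lemma harmonic_field_iff:
  assumes "open U" "U \<subseteq> H2"
  shows "harmonic_field U \<xi> \<longleftrightarrow> smooth_on U \<xi> \<and> quad_coeff \<xi> holomorphic_on U"
  using assms harmonic_field_imp_jacobi jacobi_imp_harmonic_field holomorphic_quad_coeff_iff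
  by (metis harmonic_field_def)

section \<open>Sheaves of functions\<close>

lemma cring_real_ring: "cring real_ring"
proof (rule cringI)
  show "abelian_group real_ring"
    by (rule abelian_groupI) (auto simp: real_ring_def intro: exI[of _ "- _"])
  show "comm_monoid real_ring"
    by (rule comm_monoidI) (auto simp: real_ring_def)
qed (auto simp: real_ring_def distrib_right)

lemma fun_presheaf_simps:
  "carrier (sections (fun_presheaf P) U) = {f \<in> extensional U. P U f}"
  "zero (sections (fun_presheaf P) U) = (\<lambda>x\<in>U. 0)"
  "add (sections (fun_presheaf P) U) = (\<lambda>f g. \<lambda>x\<in>U. f x + g x)"
  "smult (sections (fun_presheaf P) U) = (\<lambda>c f. \<lambda>x\<in>U. c *\<^sub>R f x)"
  "res (fun_presheaf P) U V f = restrict f V"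
  by (simp_all add: fun_presheaf_def)

text \<open>The sheaf axioms are derived once for all predicates that are linear and local. By
  \<open>cong\<close> the predicate ignores values off \<open>U\<close>, as the extension by
  \<open>undefined\<close> demands; \<open>union\<close> with an empty cover provides the section
  over the empty set.\<close>

locale function_sheaf =
  fixes X :: "'a topology" and P :: "'a set \<Rightarrow> ('a \<Rightarrow> 'b::real_vector) \<Rightarrow> bool"
  assumes cong: "\<lbrakk>openin X U; P U f; \<And>x. x \<in> U \<Longrightarrow> f x = g x\<rbrakk> \<Longrightarrow> P U g"
    and zero: "openin X U \<Longrightarrow> P U (\<lambda>x. 0)"
    and add: "\<lbrakk>openin X U; P U f; P U g\<rbrakk> \<Longrightarrow> P U (\<lambda>x. f x + g x)"
    and scale: "\<lbrakk>openin X U; P U f\<rbrakk> \<Longrightarrow> P U (\<lambda>x. c *\<^sub>R f x)"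
    and subset: "\<lbrakk>openin X U; openin X V; V \<subseteq> U; P U f\<rbrakk> \<Longrightarrow> P V f"
    and union: "(\<And>V. V \<in> \<V> \<Longrightarrow> openin X V \<and> P V f) \<Longrightarrow> P (\<Union>\<V>) f"
begin

lemma P_restrict: "\<lbrakk>openin X U; P U f\<rbrakk> \<Longrightarrow> P U (restrict f U)"
  by (rule cong) auto

lemma real_vs_sections:
  assumes U: "openin X U"
  shows "real_vs (sections (fun_presheaf P) U)"
  unfolding real_vs_def
proof (rule moduleI)
  note P_restrict[OF U, simp] zero[OF U, simp] add[OF U, simp] scale[OF U, simp]
  show "abelian_group (sections (fun_presheaf P) U)"
  proof (rule abelian_groupI)
    fix f assume f: "f \<in> carrier (sections (fun_presheaf P) U)"
    then show "\<exists>g\<in>carrier (sections (fun_presheaf P) U).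
        g \<oplus>\<^bsub>sections (fun_presheaf P) U\<^esub> f = \<zero>\<^bsub>sections (fun_presheaf P) U\<^esub>"
      using P_restrict[OF U scale[OF U, of f "-1"]]
      by (intro bexI[of _ "\<lambda>x\<in>U. - f x"]) (auto simp: fun_presheaf_simps fun_eq_iff)
  qed (auto simp: fun_presheaf_simps fun_eq_iff extensional_def add_ac)
qed (use cring_real_ring P_restrict[OF U] scale[OF U] in
    \<open>auto simp: fun_presheaf_simps real_ring_def fun_eq_iff extensional_def algebra_simps\<close>)

lemma presheaf_on: "presheaf_on X (fun_presheaf P)"
  unfolding presheaf_on_def
proof (intro conjI allI impI ballI)
  fix U V assume "openin X U \<and> openin X V \<and> V \<subseteq> U"
  then show "res (fun_presheaf P) U V \<in> vs_hom (sections (fun_presheaf P) U) (sections (fun_presheaf P) V)"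
    using P_restrict subset by (auto simp: vs_hom_def fun_presheaf_simps fun_eq_iff)
qed (auto simp: real_vs_sections fun_presheaf_simps extensional_restrict Int_absorb1)

lemma sheaf_on: "sheaf_on X (fun_presheaf P)"
  unfolding sheaf_on_def
proof (intro conjI allI impI presheaf_on)
  fix \<V> :: "'a set set" and s :: "'a set \<Rightarrow> 'a \<Rightarrow> 'b"
  let ?F = "fun_presheaf P"
  assume "(\<forall>V\<in>\<V>. openin X V \<and> s V \<in> carrier (sections ?F V)) \<and>
    (\<forall>V\<in>\<V>. \<forall>W\<in>\<V>. res ?F V (V \<inter> W) (s V) = res ?F W (V \<inter> W) (s W))"
  then have op: "\<And>V. V \<in> \<V> \<Longrightarrow> openin X V" and ext: "\<And>V. V \<in> \<V> \<Longrightarrow> s V \<in> extensional V"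
    and P: "\<And>V. V \<in> \<V> \<Longrightarrow> P V (s V)"
    and "\<And>V W. V \<in> \<V> \<Longrightarrow> W \<in> \<V> \<Longrightarrow> restrict (s V) (V \<inter> W) = restrict (s W) (V \<inter> W)"
    by (auto simp: fun_presheaf_simps)
  then have agree: "s V x = s W x" if "V \<in> \<V>" "W \<in> \<V>" "x \<in> V" "x \<in> W" for V W x
    using that by (metis IntI restrict_apply')
  \<comment> \<open>The choice of a member of the cover is harmless because of \<open>agree\<close>;
    off the union the value is \<open>undefined\<close>, which also forces uniqueness there.\<close>
  define t where "t = (\<lambda>x\<in>\<Union>\<V>. s (SOME V. V \<in> \<V> \<and> x \<in> V) x)"
  have t: "t x = s V x" if V: "V \<in> \<V>" "x \<in> V" for V x
  proof -
    let ?W = "SOME V. V \<in> \<V> \<and> x \<in> V"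
    have "?W \<in> \<V> \<and> x \<in> ?W"
      using V by (intro someI[of "\<lambda>V. V \<in> \<V> \<and> x \<in> V" V]) auto
    then have "s ?W x = s V x"
      using V agree by blast
    moreover have "t x = s ?W x"
      unfolding t_def using V by (intro restrict_apply') blast
    ultimately show ?thesis by simp
  qed
  have "P V t" if "V \<in> \<V>" for V
    using op[OF that] P[OF that] t[OF that] by (metis cong)
  then have "P (\<Union>\<V>) t"
    using op by (intro union) auto
  then have "t \<in> carrier (sections ?F (\<Union>\<V>))"
    by (simp add: fun_presheaf_simps t_def)
  moreover have "restrict t V = s V" if "V \<in> \<V>" for V
    using t[OF that] ext[OF that] by (auto simp: fun_eq_iff extensional_def)
  moreover have "u = t" if u: "u \<in> carrier (sections ?F (\<Union>\<V>))" "\<And>V. V \<in> \<V> \<Longrightarrow> restrict u V = s V" for u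
  proof
    fix x
    show "u x = t x"
    proof (cases "x \<in> \<Union>\<V>")
      case True
      then obtain V where "V \<in> \<V>" "x \<in> V" by blast
      then show ?thesis
        using u(2) t by (metis restrict_apply')
    next
      case False
      then show ?thesis
        using u(1) by (auto simp: fun_presheaf_simps t_def extensional_def)
    qed
  qed
  ultimately show "\<exists>!t. t \<in> carrier (sections ?F (\<Union>\<V>)) \<and> (\<forall>V\<in>\<V>. res ?F (\<Union>\<V>) V t = s V)"
    unfolding fun_presheaf_simps(5) by (intro ex1I[of _ t]) blast+
qed

end

section \<open>The three sheaves on the half plane\<close>

lemma open_H2: "open H2"
  unfolding H2_def by (rule open_halfspace_Im_gt)

lemma openin_H2: "openin (top_of_set H2) U \<longleftrightarrow> open U \<and> U \<subseteq> H2"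
  by (simp add: openin_open_eq open_H2)

lemma openin_H2_Im_pos: "openin (top_of_set H2) U \<Longrightarrow> p \<in> U \<Longrightarrow> Im p > 0"
  unfolding openin_H2 by (auto simp: H2_def)

text \<open>Vector fields and quadratic differentials are both represented by coefficient functions,
  so this instance also covers \<open>HQD_sheaf\<close>.\<close>

interpretation HOL: function_sheaf "top_of_set H2" "\<lambda>U \<xi>. \<xi> holomorphic_on U"
proof
  show "f holomorphic_on \<Union>\<V>"
    if "\<And>V. V \<in> \<V> \<Longrightarrow> openin (top_of_set H2) V \<and> f holomorphic_on V" for \<V> and f :: "complex \<Rightarrow> complex"
    using that holomorphic_on_UN_open[of \<V> f "\<lambda>V. V"] by (simp add: openin_H2)
qed (auto simp: scaleR_conv_of_real intro: holomorphic_transform holomorphic_on_subset intro!: holomorphic_intros)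

lemma HARM_iff:
  "openin (top_of_set H2) U \<Longrightarrow> harmonic_field U \<xi> \<longleftrightarrow> smooth_on U \<xi> \<and> quad_coeff \<xi> holomorphic_on U"
  by (simp add: openin_H2 harmonic_field_iff)

interpretation HARM: function_sheaf "top_of_set H2" harmonic_field
proof
  fix U and f g :: "complex \<Rightarrow> complex"
  assume U: "openin (top_of_set H2) U" and f: "harmonic_field U f"
  have o: "open U" using U by (simp add: openin_H2)
  have sf: "smooth_on U f" "quad_coeff f holomorphic_on U"
    using f HARM_iff[OF U] by auto
  {
    assume eq: "\<And>x. x \<in> U \<Longrightarrow> f x = g x"
    have "smooth_on U g"
      using sf(1) smooth_on_cong[of U f g] eq by blast
    moreover have "quad_coeff g holomorphic_on U"
      using sf(2) by (rule holomorphic_transform) (rule quad_coeff_cong[OF o _ eq])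
    ultimately show "harmonic_field U g"
      by (simp add: HARM_iff[OF U])
  next
    assume "harmonic_field U g"
    then have sg: "smooth_on U g" "quad_coeff g holomorphic_on U"
      using HARM_iff[OF U] by auto
    have "(\<lambda>x. quad_coeff f x + quad_coeff g x) holomorphic_on U"
      using sf(2) sg(2) by (rule holomorphic_on_add)
    then have "quad_coeff (\<lambda>x. f x + g x) holomorphic_on U"
      by (rule holomorphic_transform)
         (simp add: quad_coeff_add smooth_on_differentiable[OF o] sf(1) sg(1))
    then show "harmonic_field U (\<lambda>x. f x + g x)"
      by (simp add: HARM_iff[OF U] smooth_on_add o sf(1) sg(1))
  next
    fix c :: real
    have "(\<lambda>x. of_real c * quad_coeff f x) holomorphic_on U"
      using sf(2) by (intro holomorphic_intros)
    then have "quad_coeff (\<lambda>x. c *\<^sub>R f x) holomorphic_on U"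
      by (rule holomorphic_transform)
         (simp only: quad_coeff_scaleR[OF smooth_on_differentiable[OF o sf(1)]] flip: scaleR_conv_of_real)
    then show "harmonic_field U (\<lambda>x. c *\<^sub>R f x)"
      unfolding HARM_iff[OF U] using o sf(1) by (intro conjI smooth_on_scaleR smooth_on_const)
  next
    fix V assume "openin (top_of_set H2) V" "V \<subseteq> U"
    then show "harmonic_field V f"
      using sf smooth_on_subset holomorphic_on_subset by (simp add: HARM_iff) blast
  }
next
  show "harmonic_field U (\<lambda>x. 0)" if U: "openin (top_of_set H2) U" for U
    using U by (simp add: HARM_iff smooth_on_const openin_H2 quad_coeff_zero cong: holomorphic_cong)
next
  fix \<V> and f :: "complex \<Rightarrow> complex"
  assume V: "\<And>V. V \<in> \<V> \<Longrightarrow> openin (top_of_set H2) V \<and> harmonic_field V f"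
  then have "openin (top_of_set H2) (\<Union>\<V>)"
    by blast
  moreover have "smooth_on (\<Union>\<V>) f"
    using V by (intro smooth_on_Union) (auto simp: openin_H2 harmonic_field_def)
  \<comment> \<open>Holomorphy of the coefficient glues by the instance for holomorphic
    functions.\<close>
  moreover have "quad_coeff f holomorphic_on (\<Union>\<V>)"
    by (rule HOL.union) (use V HARM_iff in blast)
  ultimately show "harmonic_field (\<Union>\<V>) f"
    by (simp add: HARM_iff)
qed

section \<open>Exactness\<close>

lemma beta_eq:
  assumes "openin (top_of_set H2) U" "harmonic_field U \<xi>"
  shows "beta U \<xi> = restrict (quad_coeff \<xi>) U"
proof -
  have "part20 hyp_metric p (lie_metric hyp_metric \<xi> p) = quad_coeff \<xi> p" if "p \<in> U" for p
  proof -
    have "open U" "smooth_on U \<xi>"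
      using assms by (auto simp: HARM_iff openin_H2)
    then have "\<xi> differentiable (at p)" "Im p \<noteq> 0"
      using smooth_on_differentiable openin_H2_Im_pos[OF assms(1)] that by fastforce+
    then show ?thesis
      by (simp add: part20_lie_hyp_metric quad_coeff_def divide_inverse)
  qed
  then show ?thesis
    by (auto simp: beta_def fun_eq_iff)
qed

text \<open>Up to conjugation and the nonzero factor \<open>1 / y\<^sup>2\<close>, the coefficient
  is the Cauchy-Riemann expression of \<open>\<xi>\<close>.\<close>

lemma quad_coeff_eq_0_iff:
  assumes "openin (top_of_set H2) U" "smooth_on U \<xi>"
  shows "(\<forall>p\<in>U. quad_coeff \<xi> p = 0) \<longleftrightarrow> \<xi> holomorphic_on U"
proof -
  have "quad_coeff \<xi> p = 0 \<longleftrightarrow> dderiv \<xi> p 1 + \<i> * dderiv \<xi> p \<i> = 0" if "p \<in> U" for p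
  proof -
    have "Im p \<noteq> 0"
      using openin_H2_Im_pos[OF assms(1) that] by simp
    then show ?thesis
      unfolding quad_coeff_def mult_eq_0_iff complex_cnj_zero_iff by simp
  qed
  then show ?thesis
    using assms by (subst holomorphic_on_iff_Cauchy_Riemann) (auto simp: openin_H2 intro: smooth_on_differentiable)
qed

text \<open>The coefficient of a holomorphic field vanishes, and zero is holomorphic; this makes
  \<open>alpha\<close> well defined.\<close>

lemma holomorphic_imp_harmonic_field:
  assumes "openin (top_of_set H2) U" "\<xi> holomorphic_on U"
  shows "harmonic_field U \<xi>"
proof -
  have sm: "smooth_on U \<xi>"
    using assms by (auto simp: openin_H2 intro: holomorphic_on_imp_smooth_on)
  have "quad_coeff \<xi> holomorphic_on U"
    by (rule holomorphic_transform[of "\<lambda>p. 0"])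
       (use quad_coeff_eq_0_iff[OF assms(1) sm] assms(2) in auto)
  with sm show ?thesis
    by (simp add: HARM_iff[OF assms(1)])
qed

text \<open>With \<open>\<zeta> = cnj \<xi>\<close> the equation \<open>quad_coeff \<xi> = f\<close> reads
  \<open>\<partial>\<zeta>/\<partial>z = - (z - cnj z)\<^sup>2 f / 8\<close>. Expanding the square, it is solved by integrating
  \<open>f\<close>, \<open>z f\<close> and \<open>z\<^sup>2 f\<close> while treating \<open>cnj z\<close> as a constant.\<close>

lemma quad_coeff_local_surj:
  assumes V: "open V" "convex V" "V \<subseteq> H2" and f: "f holomorphic_on V"
  obtains \<xi> where "smooth_on V \<xi>" "\<And>p. p \<in> V \<Longrightarrow> quad_coeff \<xi> p = f p"
proof -
  have "\<exists>Q. \<forall>z\<in>V. (Q has_field_derivative z ^ n * f z) (at z)" for n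
  proof -
    have "(\<lambda>z. z ^ n * f z) holomorphic_on V"
      using f by (intro holomorphic_intros)
    from holomorphic_convex_primitive'[OF V(2,1) this]
    obtain Q where Q: "\<And>z. z \<in> V \<Longrightarrow> (Q has_field_derivative z ^ n * f z) (at z within V)"
      by blast
    have "(Q has_field_derivative z ^ n * f z) (at z)" if "z \<in> V" for z
      using Q[OF that] at_within_open[OF that V(1)] by simp
    then show ?thesis
      by blast
  qed
  then have "\<forall>n. \<exists>Q. \<forall>z\<in>V. (Q has_field_derivative z ^ n * f z) (at z)"
    by blast
  from choice[OF this] obtain Q
    where Q: "\<And>n z. z \<in> V \<Longrightarrow> (Q n has_field_derivative z ^ n * f z) (at z)"
    by blast
  define \<xi> where "\<xi> = (\<lambda>z. cnj ((-1/8) * (Q 2 z + ((-2) * (cnj z * Q 1 z) + cnj z * (cnj z * Q 0 z)))))"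
  have Qs: "smooth_on V (Q n)" for n
    using Q V(1) by (intro holomorphic_on_imp_smooth_on) (auto simp: holomorphic_on_open)
  have "smooth_on V \<xi>"
    unfolding \<xi>_def
    by (intro smooth_on_linear_image[of V cnj] smooth_on_mult smooth_on_add smooth_on_const
        smooth_on_bounded_linear V(1) Qs bounded_linear_cnj)
  moreover have "quad_coeff \<xi> p = f p" if "p \<in> V" for p
  proof -
    have Qd: "(Q n has_derivative (\<lambda>v. p ^ n * f p * v)) (at p)" for n
      using Q[OF that] by (simp add: has_field_derivative_def)
    have D: "(\<xi> has_derivative (\<lambda>v. cnj ((-1/8) * (p ^ 2 * f p * v
        + ((-2) * (cnj p * (p ^ 1 * f p * v) + cnj v * Q 1 p)
           + (cnj p * (cnj p * (p ^ 0 * f p * v) + cnj v * Q 0 p) + cnj v * (cnj p * Q 0 p))))))) (at p)"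
      unfolding \<xi>_def
      by (intro has_derivative_cnj has_derivative_mult_right has_derivative_add has_derivative_mult Qd
          has_derivative_ident)
    have "p - cnj p = 2 * \<i> * of_real (Im p)"
      by (simp add: complex_eq_iff)
    then have "(p - cnj p)\<^sup>2 = - 4 * of_real ((Im p)\<^sup>2)"
      by (simp add: power_mult_distrib)
    \<comment> \<open>Terms with \<open>cnj v\<close> cancel because
      \<open>1 - \<i> * cnj \<i> = 0\<close>, which removes the primitives \<open>Q\<close>; terms
      with \<open>v\<close> double because \<open>1 - \<i> * \<i> = 2\<close>, and they add up to
      the square.\<close>
    moreover have "cnj (dderiv \<xi> p 1 + \<i> * dderiv \<xi> p \<i>) = - (1/4) * (p - cnj p)\<^sup>2 * f p"
      unfolding dderiv_eq[OF D] by (simp add: power2_eq_square algebra_simps)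
    moreover have "Im p \<noteq> 0"
      using that V(3) by (auto simp: H2_def)
    ultimately show ?thesis
      by (simp add: quad_coeff_def)
  qed
  ultimately show thesis
    using that by blast
qed

text \<open>On fields differentiable at the point \<open>quad_coeff\<close> is real-linear, and on
  open sets it is insensitive to \<open>restrict\<close>.\<close>

lemma beta_hom:
  "sheaf_hom (top_of_set H2) HARM_sheaf HQD_sheaf beta"
  unfolding sheaf_hom_def HARM_sheaf_def HQD_sheaf_def
proof (intro conjI allI impI ballI)
  fix U assume U: "openin (top_of_set H2) U"
  have diff: "\<xi> differentiable (at p)" if "harmonic_field U \<xi>" "p \<in> U" for \<xi> p
    using U that by (auto simp: HARM_iff openin_H2 intro: smooth_on_differentiable)
  have restr: "quad_coeff (restrict \<xi> U) p = quad_coeff \<xi> p" if "p \<in> U" for \<xi> p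
    using U that by (intro quad_coeff_cong[of U]) (auto simp: openin_H2)
  show "beta U \<in> vs_hom (sections (fun_presheaf harmonic_field) U)
      (sections (fun_presheaf (\<lambda>U f. f holomorphic_on U)) U)"
    unfolding vs_hom_def fun_presheaf_simps
  proof (rule CollectI, intro conjI ballI allI)
    show "beta U \<in> {\<xi> \<in> extensional U. harmonic_field U \<xi>} \<rightarrow> {f \<in> extensional U. f holomorphic_on U}"
      using HARM_iff[OF U] HOL.P_restrict[OF U] by (auto simp: beta_eq[OF U])
  next
    fix \<xi> assume "\<xi> \<in> {\<xi> \<in> extensional U. harmonic_field U \<xi>}"
    then have \<xi>: "harmonic_field U \<xi>" by blast
    show "beta U (\<lambda>x\<in>U. c *\<^sub>R \<xi> x) = (\<lambda>x\<in>U. c *\<^sub>R beta U \<xi> x)" for c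
      using beta_eq[OF U HARM.P_restrict[OF U HARM.scale[OF U \<xi>]]] diff[OF \<xi>]
      by (auto simp: beta_eq[OF U \<xi>] restr quad_coeff_scaleR fun_eq_iff)
    fix \<eta> assume "\<eta> \<in> {\<xi> \<in> extensional U. harmonic_field U \<xi>}"
    then have \<eta>: "harmonic_field U \<eta>" by blast
    show "beta U (\<lambda>x\<in>U. \<xi> x + \<eta> x) = (\<lambda>x\<in>U. beta U \<xi> x + beta U \<eta> x)"
      using beta_eq[OF U HARM.P_restrict[OF U HARM.add[OF U \<xi> \<eta>]]] diff[OF \<xi>] diff[OF \<eta>]
      by (auto simp: beta_eq[OF U \<xi>] beta_eq[OF U \<eta>] restr quad_coeff_add fun_eq_iff)
  qed
next
  fix U V \<xi>
  assume "openin (top_of_set H2) U \<and> openin (top_of_set H2) V \<and> V \<subseteq> U"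
    and "\<xi> \<in> carrier (sections (fun_presheaf harmonic_field) U)"
  then have U: "openin (top_of_set H2) U" and V: "openin (top_of_set H2) V" "V \<subseteq> U"
    and \<xi>: "harmonic_field U \<xi>"
    by (auto simp: fun_presheaf_simps)
  have "quad_coeff (restrict \<xi> V) p = quad_coeff \<xi> p" if "p \<in> V" for p
    using V that by (intro quad_coeff_cong[of V]) (auto simp: openin_H2)
  then show "beta V (res (fun_presheaf harmonic_field) U V \<xi>)
      = res (fun_presheaf (\<lambda>U f. f holomorphic_on U)) U V (beta U \<xi>)"
    using V beta_eq[OF V(1) HARM.P_restrict[OF V(1) HARM.subset[OF U V \<xi>]]]
    by (auto simp: fun_presheaf_simps beta_eq[OF U \<xi>] fun_eq_iff)
qed

theorem theorem1:
  shows "short_exact_sheaves (top_of_set H2) HOL_sheaf alpha HARM_sheaf beta HQD_sheaf"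
  unfolding short_exact_sheaves_def
proof (intro conjI allI impI beta_hom)
  show "sheaf_on (top_of_set H2) HOL_sheaf" "sheaf_on (top_of_set H2) HARM_sheaf"
    "sheaf_on (top_of_set H2) HQD_sheaf"
    unfolding HOL_sheaf_def HARM_sheaf_def HQD_sheaf_def by (rule HOL.sheaf_on HARM.sheaf_on)+
  show "sheaf_hom (top_of_set H2) HOL_sheaf HARM_sheaf alpha"
    by (auto simp: sheaf_hom_def vs_hom_def alpha_def HOL_sheaf_def HARM_sheaf_def
        fun_presheaf_simps holomorphic_imp_harmonic_field)
next
  fix U assume U: "openin (top_of_set H2) U"
  show "inj_on (alpha U) (carrier (sections HOL_sheaf U))"
    by (auto simp: inj_on_def alpha_def)
  show "sheaf_image (top_of_set H2) HOL_sheaf HARM_sheaf alpha U = sheaf_kernel HARM_sheaf HQD_sheaf beta U"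
  proof (intro equalityI subsetI)
    fix \<xi> assume "\<xi> \<in> sheaf_image (top_of_set H2) HOL_sheaf HARM_sheaf alpha U"
    then have \<xi>: "\<xi> \<in> extensional U" "harmonic_field U \<xi>"
      and loc: "\<And>x. x \<in> U \<Longrightarrow> \<exists>V. openin (top_of_set H2) V \<and> x \<in> V \<and> restrict \<xi> V holomorphic_on V"
      by (auto simp: sheaf_image_def alpha_def HOL_sheaf_def HARM_sheaf_def fun_presheaf_simps image_iff)
    \<comment> \<open>Image sections are holomorphic only near each point, which suffices because
      vanishing of the coefficient is checked pointwise.\<close>
    have "quad_coeff \<xi> x = 0" if "x \<in> U" for x
    proof -
      from loc[OF that] obtain V where V: "openin (top_of_set H2) V" "x \<in> V" "restrict \<xi> V holomorphic_on V"
        by blast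
      then have "\<xi> holomorphic_on V"
        by (metis holomorphic_transform restrict_apply')
      moreover have "smooth_on V \<xi>"
        using calculation V(1) by (auto simp: openin_H2 intro: holomorphic_on_imp_smooth_on)
      ultimately show ?thesis
        using quad_coeff_eq_0_iff[OF V(1)] V(2) by blast
    qed
    then show "\<xi> \<in> sheaf_kernel HARM_sheaf HQD_sheaf beta U"
      using \<xi> beta_eq[OF U \<xi>(2)]
      by (auto simp: sheaf_kernel_def HARM_sheaf_def HQD_sheaf_def fun_presheaf_simps fun_eq_iff)
  next
    fix \<xi> assume "\<xi> \<in> sheaf_kernel HARM_sheaf HQD_sheaf beta U"
    then have \<xi>: "\<xi> \<in> extensional U" "harmonic_field U \<xi>" and "beta U \<xi> = (\<lambda>x\<in>U. 0)"
      by (auto simp: sheaf_kernel_def HARM_sheaf_def HQD_sheaf_def fun_presheaf_simps)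
    then have "quad_coeff \<xi> x = 0" if "x \<in> U" for x
      using beta_eq[OF U \<xi>(2)] that by (metis restrict_apply')
    then have "\<xi> holomorphic_on U"
      using quad_coeff_eq_0_iff[OF U] \<xi>(2) HARM_iff[OF U] by blast
    \<comment> \<open>Here \<open>U\<close> itself serves as the neighbourhood, since
      \<open>\<xi>\<close> is holomorphic on all of it.\<close>
    then show "\<xi> \<in> sheaf_image (top_of_set H2) HOL_sheaf HARM_sheaf alpha U"
      using \<xi> U
      by (auto simp: sheaf_image_def alpha_def HOL_sheaf_def HARM_sheaf_def fun_presheaf_simps
          extensional_restrict image_iff intro!: exI[of _ U])
  qed
  show "sheaf_image (top_of_set H2) HARM_sheaf HQD_sheaf beta U = carrier (sections HQD_sheaf U)"
  proof (intro equalityI subsetI)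
    fix f assume "f \<in> carrier (sections HQD_sheaf U)"
    then have f: "f \<in> extensional U" "f holomorphic_on U"
      by (auto simp: HQD_sheaf_def fun_presheaf_simps)
    have "\<exists>V. openin (top_of_set H2) V \<and> x \<in> V \<and> V \<subseteq> U \<and>
        restrict f V \<in> beta V ` {\<xi> \<in> extensional V. harmonic_field V \<xi>}" if "x \<in> U" for x
    proof -
      from U that obtain r where r: "r > 0" "ball x r \<subseteq> U"
        unfolding openin_H2 by (meson openE)
      \<comment> \<open>A ball is convex, which provides the holomorphic primitives for the local
        solution.\<close>
      define V where "V = ball x r"
      have V: "open V" "convex V" "V \<subseteq> H2" "V \<subseteq> U" "x \<in> V"
        using r U by (auto simp: V_def openin_H2)
      then have oV: "openin (top_of_set H2) V"
        by (simp add: openin_H2)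
      obtain \<xi> where \<xi>: "smooth_on V \<xi>" "\<And>p. p \<in> V \<Longrightarrow> quad_coeff \<xi> p = f p"
        using quad_coeff_local_surj[OF V(1-3) holomorphic_on_subset[OF f(2) V(4)]] by blast
      have "quad_coeff \<xi> holomorphic_on V"
        using holomorphic_on_subset[OF f(2) V(4)] by (rule holomorphic_transform) (simp add: \<xi>(2))
      then have har: "harmonic_field V (restrict \<xi> V)"
        using \<xi>(1) by (intro HARM.P_restrict oV) (simp add: HARM_iff[OF oV])
      have "quad_coeff (restrict \<xi> V) p = f p" if "p \<in> V" for p
        using \<xi>(2)[OF that] quad_coeff_cong[OF V(1) that, of "restrict \<xi> V" \<xi>] by simp
      then have "beta V (restrict \<xi> V) = restrict f V"
        unfolding beta_eq[OF oV har] by auto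
      with har oV V show ?thesis
        by (intro exI[of _ V]) (auto intro!: image_eqI[of _ _ "restrict \<xi> V"])
    qed
    then show "f \<in> sheaf_image (top_of_set H2) HARM_sheaf HQD_sheaf beta U"
      using f by (auto simp: sheaf_image_def HARM_sheaf_def HQD_sheaf_def fun_presheaf_simps)
  qed (simp add: sheaf_image_def)
qed

end
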